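(* Let us consider the differential equation $${}^{CF}\mathbf{D}_{0+}^{\alpha}y(t)=F[t,y(t)],$$ with $\alpha\in(0,1)$, where $F[t,y(t)]$ is a sufficiently regular functional of $t>0$ and $y(t)$. Then we can recast the latter in the following form: $$\frac{dy(t)}{dt}=\frac{1-\alpha}{M(\alpha)}\,\frac{d}{dt}F[t,y(t)]+\frac{\alpha}{M(\alpha)}\,F[t,y(t)]+\frac{1-\alpha}{M(\alpha)}\,F[0^+,y(0^+)]\,\delta(t),$$ which is an ordinary differential equation of the first order on the space of tempered distributions over $\mathbb{R}^+$.
   Context: The Caputo-Fabrizio (CF) operator of order $\alpha$, $0<\alpha<1$, with base point $0$ is $${}^{CF}\mathbf{D}_{0+}^{\alpha}f(t)=\frac{M(\alpha)}{1-\alpha}\int_0^t\exp\left[-\frac{\alpha}{1-\alpha}(t-\tau)\right]f'(\tau)\,d\tau,$$ where $f\in L^1(0,b)$, $b>0$, $f'$ is the first derivative of $f$, and $M(\alpha)$ is a normalization constant such that $M(0)=M(1)=1$. $F[0^+,y(0^+)]$ denotes the value of $t\mapsto F[t,y(t)]$ at $0^+$, and $\delta$ is the Dirac delta. The recasting is by the Laplace transform method, with the conventions $\mathcal{L}[f'(t);s]=s\,\tilde f(s)-f(0^+)$ and $\mathcal{L}[\delta(t);s]=1$, where $\tilde f(s)=\mathcal{L}[f(t);s]$ is the Laplace transform of $f$. *)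

theory Defs
  imports "HOL-Analysis.Analysis"
begin

text \<open>
  The Caputo-Fabrizio operator with base point 0, on functions whose derivative is integrable
  near 0.  The value of \<open>deriv f\<close> at the endpoint 0 is irrelevant for the integral.
\<close>

definition cf_derivative :: "(real \<Rightarrow> real) \<Rightarrow> real \<Rightarrow> (real \<Rightarrow> real) \<Rightarrow> real \<Rightarrow> real" where
  "cf_derivative M \<alpha> f t =
     M \<alpha> / (1 - \<alpha>) * (LINT \<tau>:{0..t}|lborel. exp (- (\<alpha> / (1 - \<alpha>)) * (t - \<tau>)) * deriv f \<tau>)"

definition schwartz :: "(real \<Rightarrow> real) \<Rightarrow> bool" where
  "schwartz \<phi> \<longleftrightarrow>
     (\<forall>n x. (deriv ^^ n) \<phi> differentiable (at x)) \<and>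
     (\<forall>k n. \<exists>C. \<forall>x. \<bar>x ^ k * (deriv ^^ n) \<phi> x\<bar> \<le> C)"

definition schwartz_seminorm :: "nat \<Rightarrow> nat \<Rightarrow> (real \<Rightarrow> real) \<Rightarrow> real" where
  "schwartz_seminorm k n \<phi> = (SUP x. \<bar>x ^ k * (deriv ^^ n) \<phi> x\<bar>)"

text \<open>
  A distribution is represented by a functional on all functions of type \<open>real \<Rightarrow> real\<close>, of
  which only the values on Schwartz functions matter; hence equality of distributions is
  \<open>dist_eq\<close> below and not equality of functionals.
\<close>

type_synonym distr = "(real \<Rightarrow> real) \<Rightarrow> real"

definition dist_eq :: "distr \<Rightarrow> distr \<Rightarrow> bool" where
  "dist_eq u v \<longleftrightarrow> (\<forall>\<phi>. schwartz \<phi> \<longrightarrow> u \<phi> = v \<phi>)"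

definition tempered_dist :: "distr \<Rightarrow> bool" where
  "tempered_dist u \<longleftrightarrow>
     (\<forall>\<phi> \<psi> a b. schwartz \<phi> \<and> schwartz \<psi> \<longrightarrow> u (\<lambda>x. a * \<phi> x + b * \<psi> x) = a * u \<phi> + b * u \<psi>) \<and>
     (\<exists>C N. \<forall>\<phi>. schwartz \<phi> \<longrightarrow> \<bar>u \<phi>\<bar> \<le> C * (\<Sum>k\<le>N. \<Sum>n\<le>N. schwartz_seminorm k n \<phi>))"

text \<open>Tempered distributions over the half line: those supported in \<open>{0..}\<close>.\<close>

definition tempered_dist_Rplus :: "distr \<Rightarrow> bool" where
  "tempered_dist_Rplus u \<longleftrightarrow>
     tempered_dist u \<and>
     (\<forall>\<phi>. schwartz \<phi> \<and> closure {x. \<phi> x \<noteq> 0} \<subseteq> {..<0} \<longrightarrow> u \<phi> = 0)"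

text \<open>
  Functions on \<open>t > 0\<close> that are integrable near 0 and of tempered growth; for these the
  regular distribution \<open>regular_dist f\<close> is given by an absolutely convergent integral bounded by
  finitely many Schwartz seminorms.  Values of \<open>f\<close> at \<open>t \<le> 0\<close> are ignored.
\<close>

definition tempered_fun :: "(real \<Rightarrow> real) \<Rightarrow> bool" where
  "tempered_fun f \<longleftrightarrow> (\<exists>N::nat. set_integrable lborel {0<..} (\<lambda>t. f t / (1 + t) ^ N))"

definition regular_dist :: "(real \<Rightarrow> real) \<Rightarrow> distr" where
  "regular_dist f \<phi> = (LINT t:{0<..}|lborel. f t * \<phi> t)"

definition dirac :: distr where
  "dirac \<phi> = \<phi> 0"

definition dist_derivative :: "distr \<Rightarrow> distr" where
  "dist_derivative u \<phi> = - u (deriv \<phi>)"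

text \<open>
  The derivative on the half line of a function \<open>f\<close> with initial value \<open>c\<close>.  The distributional
  derivative on the whole line of \<open>f\<close> extended by 0 has the Laplace transform \<open>s L[f](s)\<close>, so
  subtracting \<open>c \<delta>\<close> gives the derivative with the transform \<open>s L[f](s) - c\<close>.  If \<open>f\<close> is locally
  absolutely continuous with right limit \<open>c\<close> at 0, this is the regular distribution of the
  pointwise derivative (provided that is of tempered growth); if the right limit of \<open>f\<close> at 0 is
  not \<open>c\<close>, the jump contributes a multiple of \<open>\<delta>\<close>.
\<close>

definition halfline_derivative :: "(real \<Rightarrow> real) \<Rightarrow> real \<Rightarrow> distr" where
  "halfline_derivative f c \<phi> = dist_derivative (regular_dist f) \<phi> - c * dirac \<phi>"

text \<open>
  The Caputo-Fabrizio integral applied to a distribution \<open>v\<close> over the half line in place of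
  \<open>f'\<close>, that is, the convolution of \<open>v\<close> with the exponential kernel on the half line.  The
  formula is obtained by exchanging the integrals in
  \<open>\<integral> (\<integral>\<^sub>0\<^sup>t exp (- \<alpha> / (1 - \<alpha>) * (t - \<tau>)) * v \<tau> d\<tau>) * \<phi> t dt\<close>; the function to which
  \<open>v\<close> is applied is again a Schwartz function.
\<close>

definition cf_distribution :: "(real \<Rightarrow> real) \<Rightarrow> real \<Rightarrow> distr \<Rightarrow> distr" where
  "cf_distribution M \<alpha> v \<phi> =
     M \<alpha> / (1 - \<alpha>) * v (\<lambda>\<tau>. LINT t:{\<tau><..}|lborel. exp (- (\<alpha> / (1 - \<alpha>)) * (t - \<tau>)) * \<phi> t)"

end

(* On the half line, the Caputo-Fabrizio kernel operator K phi (tau) = int_{t > tau} exp (-c (t - tau)) phi t dt,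
   with c = alpha / (1 - alpha), is a bijection of the Schwartz space with inverse phi |-> c phi - phi'.
   Testing the equation with K phi instead of phi therefore removes the kernel, and this gives the
   equivalence between distributions.  For a pointwise solution y write g t = F t (y t), A = M alpha / (1 - alpha)
   and G for the primitive of g with G(0+) = 0.  Both the pointwise equation and the recast one are equivalent to
   y = y0 + g / A + (c / A) G on t > 0: the former by a linear first-order equation for the difference of
   the two sides, the latter because a tempered continuous function that annihilates all derivatives
   of Schwartz functions vanishes. *)
theory Submission
  imports Defs
begin

section \<open>Schwartz functions and tempered distributions\<close>

text \<open>The \<open>F0 * dirac\<close> inside \<open>halfline_derivative\<close> and the explicit
  delta term cancel, so the right side is (g' + c g) / A, with g' the derivative on the whole line
  of g extended by 0. Moved onto the test function, g' + c g becomes phi |-> c phi - phi', which is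
  the inverse of K; this is why inverting the kernel produces exactly the recast equation. The
  obstacle in the pointwise part is that g is only continuous on t > 0: dg/dt exists as a
  distribution, and the pointwise equation cannot be differentiated. The integrated equation
  contains no derivative of g and can be reached from both sides. That a function annihilating all
  derivatives is zero, and not merely constant, is due to test functions with phi 0 \<noteq> 0: a
  nonzero constant on t > 0 has a jump at 0, hence a multiple of the delta as its derivative. The
  same effect brings y0 into the integrated equation, since the integral of phi' over t > 0 is - phi
  0.\<close>

lemma schwartz_coinduct:
  assumes "\<phi> \<in> S"
    and diff: "\<And>f x. f \<in> S \<Longrightarrow> f differentiable (at x)"
    and der: "\<And>f. f \<in> S \<Longrightarrow> deriv f \<in> S"
    and bnd: "\<And>f k. f \<in> S \<Longrightarrow> \<exists>C. \<forall>x. \<bar>x ^ k * f x\<bar> \<le> C"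
  shows "schwartz \<phi>"
proof -
  \<comment> \<open>Closure under \<open>deriv\<close> puts every iterated derivative into
    \<open>S\<close>, so differentiability and decay have to be checked at order zero only and no
    formula for n-th derivatives is ever needed.\<close>
  have "(deriv ^^ n) \<phi> \<in> S" for n
    by (induction n) (use assms in auto)
  then show ?thesis
    using diff bnd by (auto simp: schwartz_def)
qed

lemma schwartz_has_derivative:
  assumes "schwartz \<phi>"
  shows "(\<phi> has_field_derivative deriv \<phi> x) (at x)"
proof -
  have "(deriv ^^ 0) \<phi> differentiable (at x)"
    using assms unfolding schwartz_def by blast
  then show ?thesis
    by (simp add: DERIV_deriv_iff_real_differentiable)
qed

lemma schwartz_deriv:
  assumes "schwartz \<phi>"
  shows "schwartz (deriv \<phi>)"
proof -
  have "(deriv ^^ n) (deriv \<phi>) = (deriv ^^ Suc n) \<phi>" for n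
    by (simp add: funpow_Suc_right del: funpow.simps)
  then show ?thesis
    using assms unfolding schwartz_def by metis
qed

lemma schwartz_isCont:
  "schwartz \<phi> \<Longrightarrow> isCont \<phi> x"
  using schwartz_has_derivative DERIV_isCont by blast

lemma schwartz_borel_measurable:
  assumes "schwartz \<phi>"
  shows "\<phi> \<in> borel_measurable borel"
  using assms by (intro borel_measurable_continuous_onI continuous_at_imp_continuous_on)
    (auto intro: schwartz_isCont)

lemma deriv_lincomb:
  assumes "schwartz \<phi>" "schwartz \<psi>"
  shows "deriv (\<lambda>x. a * \<phi> x + b * \<psi> x) = (\<lambda>x. a * deriv \<phi> x + b * deriv \<psi> x)"
  by (intro ext DERIV_imp_deriv)
    (auto intro!: derivative_eq_intros schwartz_has_derivative assms)

lemma schwartz_lincomb: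
  assumes "schwartz \<phi>" "schwartz \<psi>"
  shows "schwartz (\<lambda>x. a * \<phi> x + b * \<psi> x)"
proof (rule schwartz_coinduct)
  let ?S = "{\<lambda>x. a * f x + b * g x |f g. schwartz f \<and> schwartz g}"
  show "(\<lambda>x. a * \<phi> x + b * \<psi> x) \<in> ?S"
    using assms by blast
next
  fix h x assume "h \<in> {\<lambda>x. a * f x + b * g x |f g. schwartz f \<and> schwartz g}"
  then obtain f g where h: "h = (\<lambda>x. a * f x + b * g x)" "schwartz f" "schwartz g"
    by blast
  have "(h has_field_derivative a * deriv f x + b * deriv g x) (at x)"
    unfolding h(1) by (auto intro!: derivative_eq_intros schwartz_has_derivative h)
  then show "h differentiable (at x)"
    by (auto simp: real_differentiable_def)
next
  fix h assume "h \<in> {\<lambda>x. a * f x + b * g x |f g. schwartz f \<and> schwartz g}"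
  then obtain f g where h: "h = (\<lambda>x. a * f x + b * g x)" "schwartz f" "schwartz g"
    by blast
  have "deriv h = (\<lambda>x. a * deriv f x + b * deriv g x)"
    unfolding h(1) by (rule deriv_lincomb[OF h(2,3)])
  then show "deriv h \<in> {\<lambda>x. a * f x + b * g x |f g. schwartz f \<and> schwartz g}"
    using schwartz_deriv h(2,3) by blast
next
  fix h and k :: nat assume "h \<in> {\<lambda>x. a * f x + b * g x |f g. schwartz f \<and> schwartz g}"
  then obtain f g where h: "h = (\<lambda>x. a * f x + b * g x)" "schwartz f" "schwartz g"
    by blast
  have "\<exists>C. \<forall>x. \<bar>x ^ k * (deriv ^^ 0) f x\<bar> \<le> C" "\<exists>C. \<forall>x. \<bar>x ^ k * (deriv ^^ 0) g x\<bar> \<le> C"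
    using h(2,3) unfolding schwartz_def by blast+
  then obtain C D where C: "\<And>x. \<bar>x ^ k * f x\<bar> \<le> C" and D: "\<And>x. \<bar>x ^ k * g x\<bar> \<le> D"
    by auto
  have "\<bar>x ^ k * h x\<bar> \<le> \<bar>a\<bar> * C + \<bar>b\<bar> * D" for x
  proof -
    have "\<bar>x ^ k * h x\<bar> = \<bar>a * (x ^ k * f x) + b * (x ^ k * g x)\<bar>"
      by (simp add: h(1) algebra_simps)
    also have "\<dots> \<le> \<bar>a\<bar> * \<bar>x ^ k * f x\<bar> + \<bar>b\<bar> * \<bar>x ^ k * g x\<bar>"
      by (metis abs_mult abs_triangle_ineq)
    also have "\<dots> \<le> \<bar>a\<bar> * C + \<bar>b\<bar> * D"
      by (intro add_mono mult_left_mono C D) auto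
    finally show ?thesis .
  qed
  then show "\<exists>C. \<forall>x. \<bar>x ^ k * h x\<bar> \<le> C"
    by blast
qed

section \<open>Seminorm estimates and weighted integrability\<close>

lemma seminorm_upper:
  assumes "schwartz \<phi>"
  shows "\<bar>x ^ k * (deriv ^^ n) \<phi> x\<bar> \<le> schwartz_seminorm k n \<phi>"
proof -
  obtain C where "\<And>x. \<bar>x ^ k * (deriv ^^ n) \<phi> x\<bar> \<le> C"
    using assms unfolding schwartz_def by blast
  then show ?thesis
    unfolding schwartz_seminorm_def by (intro cSUP_upper bdd_aboveI2[where M = C]) auto
qed

lemma seminorm_nonneg:
  "schwartz \<phi> \<Longrightarrow> 0 \<le> schwartz_seminorm k n \<phi>"
  by (rule order_trans[OF abs_ge_zero seminorm_upper])

lemma seminorm_deriv: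
  "schwartz_seminorm k n (deriv \<phi>) = schwartz_seminorm k (Suc n) \<phi>"
  by (simp add: schwartz_seminorm_def funpow_Suc_right del: funpow.simps)

text \<open>Binomial expansion of \<open>(1 + t) ^ N\<close>, with every binomial coefficient
  estimated by \<open>2 ^ N\<close>. It converts the weight in \<open>tempered_fun\<close> into
  finitely many seminorms.\<close>

lemma schwartz_weight_bound:
  assumes "schwartz \<phi>" "0 \<le> t"
  shows "(1 + t) ^ N * \<bar>\<phi> t\<bar> \<le> 2 ^ N * (\<Sum>k\<le>N. schwartz_seminorm k 0 \<phi>)"
proof -
  have "(1 + t) ^ N * \<bar>\<phi> t\<bar> = (\<Sum>k\<le>N. real (N choose k) * (t ^ k * \<bar>\<phi> t\<bar>))"
    using binomial_ring[of t 1 N] by (simp add: add.commute sum_distrib_right mult.assoc)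
  also have "\<dots> \<le> (\<Sum>k\<le>N. 2 ^ N * schwartz_seminorm k 0 \<phi>)"
  proof (intro sum_mono mult_mono)
    fix k
    show "real (N choose k) \<le> 2 ^ N"
      by (metis binomial_le_pow2 of_nat_le_iff of_nat_numeral of_nat_power)
    show "t ^ k * \<bar>\<phi> t\<bar> \<le> schwartz_seminorm k 0 \<phi>"
      using seminorm_upper[OF assms(1), of t k 0] assms(2) by (simp add: abs_mult)
  qed (use assms in auto)
  finally show ?thesis
    by (simp add: sum_distrib_left)
qed

text \<open>The weight is shared out: \<open>f\<close> divided by \<open>(1 + t) ^ N\<close> is
  integrable, and \<phi> multiplied by it is bounded.\<close>

lemma tempered_schwartz_integrable:
  assumes "tempered_fun f" "schwartz \<phi>"
  shows "set_integrable lborel {0<..} (\<lambda>t. f t * \<phi> t)"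
proof -
  obtain N :: nat where N: "set_integrable lborel {0<..} (\<lambda>t. f t / (1 + t) ^ N)"
    using assms(1) tempered_fun_def by blast
  define C where "C = 2 ^ N * (\<Sum>k\<le>N. schwartz_seminorm k 0 \<phi>)"
  note [measurable] = schwartz_borel_measurable[OF assms(2)]
  have eq: "f t * \<phi> t = f t / (1 + t) ^ N * ((1 + t) ^ N * \<phi> t)" if "t > 0" for t
    using that by simp
  show ?thesis
  proof (rule set_integrable_bound)
    show "set_integrable lborel {0<..} (\<lambda>t. C * (f t / (1 + t) ^ N))"
      by (intro set_integrable_mult_right N)
    \<comment> \<open>Measurability of \<open>f\<close> on the half line is encoded only in the
      integrability of the weighted quotient, so the product is factored through that
      quotient.\<close>
    have [measurable]: "(\<lambda>t. indicator {0<..} t *\<^sub>R (f t / (1 + t) ^ N)) \<in> borel_measurable lborel"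
      using N unfolding set_integrable_def by (rule borel_measurable_integrable)
    have "(\<lambda>t. indicator {0<..} t *\<^sub>R (f t * \<phi> t)) =
        (\<lambda>t. indicator {0<..} t *\<^sub>R (f t / (1 + t) ^ N) * ((1 + t) ^ N * \<phi> t))"
      by (intro ext) (simp add: indicator_def)
    moreover have "\<dots> \<in> borel_measurable lborel"
      by measurable
    ultimately show "set_borel_measurable lborel {0<..} (\<lambda>t. f t * \<phi> t)"
      by (simp add: set_borel_measurable_def)
    show "AE t in lborel. t \<in> {0<..} \<longrightarrow> norm (f t * \<phi> t) \<le> norm (C * (f t / (1 + t) ^ N))"
    proof (intro AE_I2 impI)
      fix t :: real assume "t \<in> {0<..}"
      then have t: "0 < t" by simp
      have "norm (f t * \<phi> t) = \<bar>f t / (1 + t) ^ N\<bar> * ((1 + t) ^ N * \<bar>\<phi> t\<bar>)"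
        using eq[OF t] t by (simp add: abs_mult)
      also have "\<dots> \<le> \<bar>f t / (1 + t) ^ N\<bar> * C"
        unfolding C_def using t by (intro mult_left_mono schwartz_weight_bound assms) auto
      also have "\<dots> \<le> \<bar>f t / (1 + t) ^ N\<bar> * \<bar>C\<bar>"
        by (intro mult_left_mono) auto
      finally show "norm (f t * \<phi> t) \<le> norm (C * (f t / (1 + t) ^ N))"
        by (simp only: real_norm_def abs_mult mult.commute)
    qed
  qed
qed

section \<open>Tempered distributions: regular ones, derivatives and the delta\<close>

lemma regular_dist_lincomb:
  assumes "tempered_fun f" "schwartz \<phi>" "schwartz \<psi>"
  shows "regular_dist f (\<lambda>x. a * \<phi> x + b * \<psi> x) = a * regular_dist f \<phi> + b * regular_dist f \<psi>"
proof -
  have "regular_dist f (\<lambda>x. a * \<phi> x + b * \<psi> x) =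
      (LINT t:{0<..}|lborel. a * (f t * \<phi> t) + b * (f t * \<psi> t))"
    unfolding regular_dist_def by (rule set_lebesgue_integral_cong) (auto simp: algebra_simps)
  also have "\<dots> = a * regular_dist f \<phi> + b * regular_dist f \<psi>"
    unfolding regular_dist_def using assms
    by (subst set_integral_add(2)) (auto intro: tempered_schwartz_integrable)
  finally show ?thesis .
qed

lemma tempered_regular_dist:
  assumes "tempered_fun f"
  shows "tempered_dist (regular_dist f)"
proof -
  obtain N :: nat where N: "set_integrable lborel {0<..} (\<lambda>t. f t / (1 + t) ^ N)"
    using assms(1) tempered_fun_def by blast
  \<comment> \<open>The weighted L1 norm of \<open>f\<close>; together with the factor
    \<open>2 ^ N\<close> of \<open>schwartz_weight_bound\<close> it is the continuity
    constant.\<close>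
  define I where "I = (LINT t:{0<..}|lborel. \<bar>f t / (1 + t) ^ N\<bar>)"
  have I: "0 \<le> I"
    unfolding I_def set_lebesgue_integral_def by (rule integral_nonneg_AE) (auto simp: indicator_def)
  have "\<bar>regular_dist f \<phi>\<bar> \<le> (I * 2 ^ N) * (\<Sum>k\<le>N. \<Sum>n\<le>N. schwartz_seminorm k n \<phi>)"
    if \<phi>: "schwartz \<phi>" for \<phi>
  proof -
    let ?C = "2 ^ N * (\<Sum>k\<le>N. schwartz_seminorm k 0 \<phi>)"
    have "\<bar>regular_dist f \<phi>\<bar> \<le> (LINT t:{0<..}|lborel. norm (f t * \<phi> t))"
      unfolding regular_dist_def real_norm_def[symmetric]
      by (intro set_integral_norm_bound tempered_schwartz_integrable assms \<phi>)
    also have "\<dots> \<le> (LINT t:{0<..}|lborel. \<bar>f t / (1 + t) ^ N\<bar> * ?C)"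
    proof (rule set_integral_mono)
      show "set_integrable lborel {0<..} (\<lambda>t. norm (f t * \<phi> t))"
        unfolding real_norm_def
        by (intro set_integrable_abs tempered_schwartz_integrable assms \<phi>)
      show "set_integrable lborel {0<..} (\<lambda>t. \<bar>f t / (1 + t) ^ N\<bar> * ?C)"
        by (intro set_integrable_mult_left set_integrable_abs N)
      fix t :: real assume "t \<in> {0<..}"
      then have t: "0 < t" by simp
      have "norm (f t * \<phi> t) = \<bar>f t / (1 + t) ^ N\<bar> * ((1 + t) ^ N * \<bar>\<phi> t\<bar>)"
        using t by (simp add: abs_mult)
      also have "\<dots> \<le> \<bar>f t / (1 + t) ^ N\<bar> * ?C"
        using t by (intro mult_left_mono schwartz_weight_bound \<phi>) auto
      finally show "norm (f t * \<phi> t) \<le> \<bar>f t / (1 + t) ^ N\<bar> * ?C" .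
    qed
    also have "\<dots> = (I * 2 ^ N) * (\<Sum>k\<le>N. schwartz_seminorm k 0 \<phi>)"
      by (simp only: set_integral_mult_left I_def mult.assoc)
    also have "\<dots> \<le> (I * 2 ^ N) * (\<Sum>k\<le>N. \<Sum>n\<le>N. schwartz_seminorm k n \<phi>)"
      using I seminorm_nonneg[OF \<phi>]
      by (intro mult_left_mono sum_mono member_le_sum) auto
    finally show ?thesis .
  qed
  then show ?thesis
    unfolding tempered_dist_def using regular_dist_lincomb[OF assms] by blast
qed

lemma tempered_dist_derivative:
  assumes "tempered_dist u"
  shows "tempered_dist (dist_derivative u)"
proof -
  obtain C N where C: "\<And>\<phi>. schwartz \<phi> \<Longrightarrow> \<bar>u \<phi>\<bar> \<le> C * (\<Sum>k\<le>N. \<Sum>n\<le>N. schwartz_seminorm k n \<phi>)"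
    using assms unfolding tempered_dist_def by blast
  \<comment> \<open>Differentiation raises the order of each seminorm by one, hence
    \<open>Suc N\<close>; \<open>C\<close> may be negative, and enlarging the sum is monotone only
    with its absolute value.\<close>
  have "\<bar>dist_derivative u \<phi>\<bar> \<le> \<bar>C\<bar> * (\<Sum>k\<le>Suc N. \<Sum>n\<le>Suc N. schwartz_seminorm k n \<phi>)"
    if \<phi>: "schwartz \<phi>" for \<phi>
  proof -
    let ?s = "\<lambda>k n. schwartz_seminorm k n \<phi>"
    have "\<bar>dist_derivative u \<phi>\<bar> \<le> C * (\<Sum>k\<le>N. \<Sum>n\<le>N. ?s k (Suc n))"
      using C[OF schwartz_deriv[OF \<phi>]] by (simp add: dist_derivative_def seminorm_deriv)
    also have "\<dots> \<le> \<bar>C\<bar> * (\<Sum>k\<le>N. \<Sum>n\<le>N. ?s k (Suc n))"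
      by (intro mult_right_mono sum_nonneg seminorm_nonneg \<phi>) auto
    also have "\<dots> \<le> \<bar>C\<bar> * (\<Sum>k\<le>Suc N. \<Sum>n\<le>Suc N. ?s k n)"
    proof (intro mult_left_mono)
      have "(\<Sum>k\<le>N. \<Sum>n\<le>N. ?s k (Suc n)) \<le> (\<Sum>k\<le>N. \<Sum>n\<le>Suc N. ?s k n)"
        by (intro sum_mono) (simp add: sum.atMost_Suc_shift seminorm_nonneg \<phi> del: sum.atMost_Suc)
      also have "\<dots> \<le> (\<Sum>k\<le>Suc N. \<Sum>n\<le>Suc N. ?s k n)"
        by (intro sum_mono2 sum_nonneg seminorm_nonneg \<phi>) auto
      finally show "(\<Sum>k\<le>N. \<Sum>n\<le>N. ?s k (Suc n)) \<le> (\<Sum>k\<le>Suc N. \<Sum>n\<le>Suc N. ?s k n)" .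
    qed simp
    finally show ?thesis .
  qed
  moreover have "dist_derivative u (\<lambda>x. a * \<phi> x + b * \<psi> x) =
      a * dist_derivative u \<phi> + b * dist_derivative u \<psi>" if "schwartz \<phi>" "schwartz \<psi>" for a b \<phi> \<psi>
  proof -
    have "u (\<lambda>x. a * deriv \<phi> x + b * deriv \<psi> x) = a * u (deriv \<phi>) + b * u (deriv \<psi>)"
      using assms schwartz_deriv that unfolding tempered_dist_def by blast
    then show ?thesis
      by (simp add: dist_derivative_def deriv_lincomb that)
  qed
  ultimately show ?thesis
    unfolding tempered_dist_def by blast
qed

lemma tempered_dirac: "tempered_dist dirac"
proof -
  have "\<forall>\<phi>. schwartz \<phi> \<longrightarrow> \<bar>dirac \<phi>\<bar> \<le> 1 * (\<Sum>k\<le>0. \<Sum>n\<le>0. schwartz_seminorm k n \<phi>)"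
    using seminorm_upper[where x = 0 and k = 0 and n = 0] by (simp add: dirac_def)
  then have "\<exists>C N. \<forall>\<phi>. schwartz \<phi> \<longrightarrow>
      \<bar>dirac \<phi>\<bar> \<le> C * (\<Sum>k\<le>N. \<Sum>n\<le>N. schwartz_seminorm k n \<phi>)"
    by blast
  moreover have "dirac (\<lambda>x. a * \<phi> x + b * \<psi> x) = a * dirac \<phi> + b * dirac \<psi>" for a b \<phi> \<psi>
    by (simp add: dirac_def)
  ultimately show ?thesis
    unfolding tempered_dist_def by blast
qed

lemma tempered_dist_diff_scaled:
  assumes "tempered_dist u" "tempered_dist v"
  shows "tempered_dist (\<lambda>\<phi>. u \<phi> - c * v \<phi>)"
proof -
  obtain C N where C: "\<And>\<phi>. schwartz \<phi> \<Longrightarrow> \<bar>u \<phi>\<bar> \<le> C * (\<Sum>k\<le>N. \<Sum>n\<le>N. schwartz_seminorm k n \<phi>)"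
    using assms unfolding tempered_dist_def by blast
  obtain D L where D: "\<And>\<phi>. schwartz \<phi> \<Longrightarrow> \<bar>v \<phi>\<bar> \<le> D * (\<Sum>k\<le>L. \<Sum>n\<le>L. schwartz_seminorm k n \<phi>)"
    using assms unfolding tempered_dist_def by blast
  have "\<bar>u \<phi> - c * v \<phi>\<bar> \<le>
      (\<bar>C\<bar> + \<bar>c\<bar> * \<bar>D\<bar>) * (\<Sum>k\<le>max N L. \<Sum>n\<le>max N L. schwartz_seminorm k n \<phi>)"
    if \<phi>: "schwartz \<phi>" for \<phi>
  proof -
    let ?S = "\<lambda>N. \<Sum>k\<le>N. \<Sum>n\<le>N. schwartz_seminorm k n \<phi>"
    have mono: "?S m \<le> ?S n" if "m \<le> n" for m n
    proof -
      have "?S m \<le> (\<Sum>k\<le>m. \<Sum>j\<le>n. schwartz_seminorm k j \<phi>)"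
        using that by (intro sum_mono sum_mono2 seminorm_nonneg \<phi>) auto
      also have "\<dots> \<le> ?S n"
        using that by (intro sum_mono2 sum_nonneg seminorm_nonneg \<phi>) auto
      finally show ?thesis .
    qed
    have nonneg: "0 \<le> ?S n" for n
      by (intro sum_nonneg seminorm_nonneg \<phi>)
    have "\<bar>u \<phi>\<bar> \<le> \<bar>C\<bar> * ?S (max N L)"
      by (rule order_trans[OF C[OF \<phi>]]) (intro mult_mono mono nonneg; simp)
    moreover have "\<bar>v \<phi>\<bar> \<le> \<bar>D\<bar> * ?S (max N L)"
      by (rule order_trans[OF D[OF \<phi>]]) (intro mult_mono mono nonneg; simp)
    then have "\<bar>c * v \<phi>\<bar> \<le> \<bar>c\<bar> * (\<bar>D\<bar> * ?S (max N L))"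
      unfolding abs_mult by (rule mult_left_mono) simp
    ultimately show ?thesis
      unfolding distrib_right mult.assoc by linarith
  qed
  moreover have "u (\<lambda>x. a * \<phi> x + b * \<psi> x) - c * v (\<lambda>x. a * \<phi> x + b * \<psi> x) =
      a * (u \<phi> - c * v \<phi>) + b * (u \<psi> - c * v \<psi>)" if "schwartz \<phi>" "schwartz \<psi>" for a b \<phi> \<psi>
  proof -
    have "u (\<lambda>x. a * \<phi> x + b * \<psi> x) = a * u \<phi> + b * u \<psi>"
      "v (\<lambda>x. a * \<phi> x + b * \<psi> x) = a * v \<phi> + b * v \<psi>"
      using assms that unfolding tempered_dist_def by blast+
    then show ?thesis
      by (simp add: algebra_simps)
  qed
  ultimately show ?thesis
    unfolding tempered_dist_def by blast
qed

section \<open>Support in the closed half line\<close>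

lemma zero_on_nonneg:
  assumes "closure {x. \<phi> x \<noteq> 0} \<subseteq> {..<0::real}" "0 \<le> x"
  shows "\<phi> x = (0::real)"
  using subsetD[OF assms(1) subsetD[OF closure_subset], of x] assms(2) by force

lemma tempered_regular_dist_Rplus:
  assumes "tempered_fun f"
  shows "tempered_dist_Rplus (regular_dist f)"
proof -
  have "regular_dist f \<phi> = 0" if "closure {x. \<phi> x \<noteq> 0} \<subseteq> {..<0}" for \<phi>
  proof -
    have "regular_dist f \<phi> = (LINT t:{0::real<..}|lborel. 0)"
      unfolding regular_dist_def
      by (rule set_lebesgue_integral_cong) (auto simp: zero_on_nonneg[OF that])
    then show ?thesis by simp
  qed
  then show ?thesis
    using tempered_regular_dist[OF assms] by (auto simp: tempered_dist_Rplus_def)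
qed

lemma tempered_dirac_Rplus: "tempered_dist_Rplus dirac"
proof -
  have "dirac \<phi> = 0" if "closure {x. \<phi> x \<noteq> 0} \<subseteq> {..<0}" for \<phi>
    using zero_on_nonneg[OF that] by (simp add: dirac_def)
  then show ?thesis
    using tempered_dirac by (auto simp: tempered_dist_Rplus_def)
qed

lemma tempered_halfline_derivative_Rplus:
  assumes "tempered_fun f"
  shows "tempered_dist_Rplus (halfline_derivative f c)"
proof -
  have "halfline_derivative f c \<phi> = 0" if supp: "closure {x. \<phi> x \<noteq> 0} \<subseteq> {..<0}" for \<phi>
  proof -
    have d: "deriv \<phi> t = 0" if "t > 0" for t
    proof -
      have "\<forall>\<^sub>F x in nhds t. \<phi> x = 0"
        using eventually_nhds_in_open[of "{0<..}" t] that
        by (auto elim!: eventually_mono simp: zero_on_nonneg[OF supp])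
      then have "deriv \<phi> t = deriv (\<lambda>x. 0) t"
        by (rule deriv_cong_ev) simp
      then show ?thesis by simp
    qed
    have "regular_dist f (deriv \<phi>) = (LINT t:{0::real<..}|lborel. 0)"
      unfolding regular_dist_def by (rule set_lebesgue_integral_cong) (auto simp: d)
    then show ?thesis
      by (simp add: halfline_derivative_def dist_derivative_def dirac_def zero_on_nonneg[OF supp])
  qed
  moreover have "tempered_dist (\<lambda>\<phi>. dist_derivative (regular_dist f) \<phi> - c * dirac \<phi>)"
    by (intro tempered_dist_diff_scaled tempered_dist_derivative tempered_regular_dist assms
        tempered_dirac)
  then have "tempered_dist (halfline_derivative f c)"
    by (simp add: halfline_derivative_def[abs_def])
  ultimately show ?thesis
    by (auto simp: tempered_dist_Rplus_def)
qed

section \<open>Exponential averages of Schwartz functions\<close>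

lemma half_line_FTC:
  fixes F f :: "real \<Rightarrow> real"
  assumes "\<And>t. a < t \<Longrightarrow> (F has_field_derivative f t) (at t)"
    and "\<And>t. a < t \<Longrightarrow> isCont f t"
    and "set_integrable lborel {a<..} f"
    and "(F \<longlongrightarrow> A) (at_right a)" "(F \<longlongrightarrow> B) at_top"
  shows "(LINT t:{a<..}|lborel. f t) = B - A"
proof -
  have "(LBINT t=ereal a..\<infinity>. f t) = B - A"
    using assms
    by (intro interval_integral_FTC_integrable[where F = F])
      (auto simp: has_real_derivative_iff_has_vector_derivative ereal_tendsto_simps)
  then show ?thesis
    by (simp add: interval_integral_to_infinity_eq)
qed

lemma exp_shift_tendsto_0:
  assumes "0 < c"
  shows "((\<lambda>t::real. exp (- c * (t - \<tau>))) \<longlongrightarrow> 0) at_top"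
  using assms by real_asymp

lemma exp_tail:
  fixes c \<tau> :: real
  assumes "0 < c"
  shows "set_integrable lborel {\<tau><..} (\<lambda>t. exp (- c * (t - \<tau>)))"
    and "(LINT t:{\<tau><..}|lborel. exp (- c * (t - \<tau>))) = 1 / c"
proof -
  have lim0: "((\<lambda>t. - exp (- c * (t - \<tau>)) / c) \<longlongrightarrow> - 1 / c) (at_right \<tau>)"
    using assms by (auto intro!: tendsto_eq_intros)
  have lim1: "((\<lambda>t. - exp (- c * (t - \<tau>)) / c) \<longlongrightarrow> 0) at_top"
    using tendsto_divide[OF tendsto_minus[OF exp_shift_tendsto_0[OF assms, of \<tau>]] tendsto_const[of c]]
      assms by simp
  have D: "((\<lambda>t. - exp (- c * (t - \<tau>)) / c) has_field_derivative exp (- c * (t - \<tau>))) (at t)" for t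
    using assms by (auto intro!: derivative_eq_intros)
  have "set_integrable lborel (einterval (ereal \<tau>) \<infinity>) (\<lambda>t. exp (- c * (t - \<tau>)))"
    "(LBINT t=ereal \<tau>..\<infinity>. exp (- c * (t - \<tau>))) = 0 - (- 1 / c)"
    using lim0 lim1 D
    by (intro interval_integral_FTC_nonneg[where F = "\<lambda>t. - exp (- c * (t - \<tau>)) / c"];
        auto simp: ereal_tendsto_simps)+
  then show "set_integrable lborel {\<tau><..} (\<lambda>t. exp (- c * (t - \<tau>)))"
    "(LINT t:{\<tau><..}|lborel. exp (- c * (t - \<tau>))) = 1 / c"
    by (simp_all add: interval_integral_to_infinity_eq)
qed

text \<open>The operator K: the transpose of convolution with the kernel
  \<open>exp (- c * t)\<close> on t > 0, or the resolvent of differentiation at \<open>c\<close> on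
  Schwartz functions.\<close>

definition exp_average :: "real \<Rightarrow> (real \<Rightarrow> real) \<Rightarrow> real \<Rightarrow> real" where
  "exp_average c \<phi> \<tau> = (LINT t:{\<tau><..}|lborel. exp (- c * (t - \<tau>)) * \<phi> t)"

lemma exp_average_integrable:
  assumes "0 < c" "schwartz \<phi>"
  shows "set_integrable lborel {\<tau><..} (\<lambda>t. exp (- c * (t - \<tau>)) * \<phi> t)"
proof (rule set_integrable_bound)
  let ?C = "schwartz_seminorm 0 0 \<phi>"
  note [measurable] = schwartz_borel_measurable[OF assms(2)]
  show "set_integrable lborel {\<tau><..} (\<lambda>t. exp (- c * (t - \<tau>)) * ?C)"
    by (intro set_integrable_mult_left exp_tail assms)
  show "set_borel_measurable lborel {\<tau><..} (\<lambda>t. exp (- c * (t - \<tau>)) * \<phi> t)"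
    unfolding set_borel_measurable_def by measurable
  show "AE t in lborel. t \<in> {\<tau><..} \<longrightarrow>
      norm (exp (- c * (t - \<tau>)) * \<phi> t) \<le> norm (exp (- c * (t - \<tau>)) * ?C)"
  proof (intro AE_I2 impI)
    fix t
    have "\<bar>\<phi> t\<bar> \<le> \<bar>?C\<bar>"
      using seminorm_upper[OF assms(2), of t 0 0] by simp
    then show "norm (exp (- c * (t - \<tau>)) * \<phi> t) \<le> norm (exp (- c * (t - \<tau>)) * ?C)"
      by (simp add: abs_mult)
  qed
qed

lemma exp_average_lincomb:
  assumes "0 < c" "schwartz \<phi>" "schwartz \<psi>"
  shows "exp_average c (\<lambda>t. a * \<phi> t + b * \<psi> t) \<tau> = a * exp_average c \<phi> \<tau> + b * exp_average c \<psi> \<tau>"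
proof -
  have "exp_average c (\<lambda>t. a * \<phi> t + b * \<psi> t) \<tau> =
      (LINT t:{\<tau><..}|lborel. a * (exp (- c * (t - \<tau>)) * \<phi> t) + b * (exp (- c * (t - \<tau>)) * \<psi> t))"
    unfolding exp_average_def by (rule set_lebesgue_integral_cong) (auto simp: algebra_simps)
  also have "\<dots> = a * exp_average c \<phi> \<tau> + b * exp_average c \<psi> \<tau>"
    unfolding exp_average_def
    by (subst set_integral_add(2))
      (simp_all only: set_integrable_mult_right exp_average_integrable[OF assms(1)] assms
        set_integral_mult_right)
  finally show ?thesis .
qed

text \<open>The integrand is the derivative of
  \<open>- (exp (- c * (t - \<tau>)) * \<psi> t)\<close>, which vanishes at infinity because \<psi>
  is bounded, so only the boundary term at \<tau> survives.\<close>

lemma exp_average_inverse: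
  assumes "0 < c" "schwartz \<psi>"
  shows "exp_average c (\<lambda>t. c * \<psi> t - deriv \<psi> t) \<tau> = \<psi> \<tau>"
proof -
  let ?F = "\<lambda>t. - (exp (- c * (t - \<tau>)) * \<psi> t)"
  have schw: "schwartz (\<lambda>t. c * \<psi> t - deriv \<psi> t)"
    using schwartz_lincomb[OF assms(2) schwartz_deriv[OF assms(2)], of c "-1"] by simp
  have "(LINT t:{\<tau><..}|lborel. exp (- c * (t - \<tau>)) * (c * \<psi> t - deriv \<psi> t)) = 0 - (- \<psi> \<tau>)"
  proof (rule half_line_FTC)
    show "(?F has_field_derivative exp (- c * (t - \<tau>)) * (c * \<psi> t - deriv \<psi> t)) (at t)" for t
      by (auto intro!: derivative_eq_intros schwartz_has_derivative[OF assms(2)]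
          simp: algebra_simps)
    show "isCont (\<lambda>t. exp (- c * (t - \<tau>)) * (c * \<psi> t - deriv \<psi> t)) t" for t
      by (intro continuous_intros schwartz_isCont[OF schw])
    show "set_integrable lborel {\<tau><..} (\<lambda>t. exp (- c * (t - \<tau>)) * (c * \<psi> t - deriv \<psi> t))"
      by (rule exp_average_integrable[OF assms(1) schw])
    have "isCont ?F \<tau>"
      by (intro continuous_intros schwartz_isCont[OF assms(2)])
    then have "(?F \<longlongrightarrow> - \<psi> \<tau>) (at \<tau>)"
      by (simp add: isCont_def)
    then show "(?F \<longlongrightarrow> - \<psi> \<tau>) (at_right \<tau>)"
      by (rule tendsto_mono[rotated]) (simp add: at_le)
    have "((\<lambda>t. exp (- c * (t - \<tau>)) * \<psi> t) \<longlongrightarrow> 0) at_top"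
    proof (rule tendsto_0_le[OF exp_shift_tendsto_0[OF assms(1), of \<tau>]])
      have "norm (exp (- c * (t - \<tau>)) * \<psi> t) \<le> norm (exp (- c * (t - \<tau>))) * schwartz_seminorm 0 0 \<psi>" for t
        using seminorm_upper[OF assms(2), of t 0 0] by (simp add: abs_mult)
      then show "\<forall>\<^sub>F t in at_top. norm (exp (- c * (t - \<tau>)) * \<psi> t)
          \<le> norm (exp (- c * (t - \<tau>))) * schwartz_seminorm 0 0 \<psi>"
        by (simp only: eventually_True)
    qed
    then show "(?F \<longlongrightarrow> 0) at_top"
      using tendsto_minus by fastforce
  qed
  then show ?thesis
    by (simp add: exp_average_def)
qed

text \<open>The preceding identity split by linearity. Combined with (K phi)' = K phi' below, it
  also gives c K phi - (K phi)' = phi, the other half of the bijection.\<close>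

lemma exp_average_deriv:
  assumes "0 < c" "schwartz \<phi>"
  shows "exp_average c (deriv \<phi>) \<tau> = c * exp_average c \<phi> \<tau> - \<phi> \<tau>"
  using exp_average_inverse[OF assms, of \<tau>]
    exp_average_lincomb[OF assms(1) assms(2) schwartz_deriv[OF assms(2)], of c "-1" \<tau>]
  by simp

text \<open>Pulling the factor \<open>exp (c * s)\<close> out of the integral leaves a tail integral
  that depends on \<open>s\<close> through its lower limit only. The product rule then yields c K
  phi - phi, which \<open>exp_average_deriv\<close> identifies.\<close>

lemma exp_average_has_derivative:
  assumes "0 < c" "schwartz \<phi>"
  shows "(exp_average c \<phi> has_field_derivative exp_average c (deriv \<phi>) \<tau>) (at \<tau>)"
proof -
  define h where "h t = exp (- c * t) * \<phi> t" for t
  \<comment> \<open>A base point to the left of \<tau>, so that near \<tau> the tail is a constant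
    minus a primitive over a compact interval.\<close>
  define a where "a = \<tau> - 1"
  have cont: "continuous_on S h" for S
    unfolding h_def
    by (intro continuous_intros continuous_at_imp_continuous_on ballI schwartz_isCont assms)
  have tail: "set_integrable lborel {s<..} h"
    "exp_average c \<phi> s = exp (c * s) * (LINT t:{s<..}|lborel. h t)" for s
  proof -
    have *: "exp (- c * (t - s)) * \<phi> t = exp (c * s) * h t" for t
      by (simp add: h_def algebra_simps flip: exp_add)
    show "set_integrable lborel {s<..} h"
      using exp_average_integrable[OF assms, of s] unfolding * by simp
    show "exp_average c \<phi> s = exp (c * s) * (LINT t:{s<..}|lborel. h t)"
      unfolding exp_average_def * by simp
  qed
  have split: "(LINT t:{s<..}|lborel. h t) = (LINT t:{a<..}|lborel. h t) - integral {a..s} h"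
    if "a < s" for s
  proof -
    have int: "set_integrable lborel {a..s} h"
      by (rule borel_integrable_atLeastAtMost'[OF cont])
    have "(LINT t:{a..}|lborel. h t) = (LINT t:{a..s} \<union> {s<..}|lborel. h t)"
      using that by (intro arg_cong2[where f = "\<lambda>A f. set_lebesgue_integral lborel A f"]) auto
    also have "\<dots> = (LINT t:{a..s}|lborel. h t) + (LINT t:{s<..}|lborel. h t)"
      using int tail(1) by (intro set_integral_Un) auto
    also have "(LINT t:{a..}|lborel. h t) = (LINT t:{a<..}|lborel. h t)"
      by (intro set_integral_discrete_difference[where X = "{a}"]) auto
    finally show ?thesis
      using set_borel_integral_eq_integral(2)[OF int] by simp
  qed
  have "((\<lambda>s. integral {a..s} h) has_field_derivative h \<tau>) (at \<tau> within {a..\<tau> + 1})"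
    by (rule integral_has_real_derivative[OF cont]) (simp add: a_def)
  then have I: "((\<lambda>s. integral {a..s} h) has_field_derivative h \<tau>) (at \<tau>)"
    by (subst (asm) at_within_Icc_at) (auto simp: a_def)
  let ?J = "LINT t:{a<..}|lborel. h t"
  have "((\<lambda>s. exp (c * s) * (?J - integral {a..s} h)) has_field_derivative
      c * exp (c * \<tau>) * (?J - integral {a..\<tau>} h) - exp (c * \<tau>) * h \<tau>) (at \<tau>)"
    by (auto intro!: derivative_eq_intros I simp: algebra_simps)
  moreover have "c * exp (c * \<tau>) * (?J - integral {a..\<tau>} h) - exp (c * \<tau>) * h \<tau> =
      exp_average c (deriv \<phi>) \<tau>"
    unfolding exp_average_deriv[OF assms] tail(2)
    by (subst split) (simp_all add: a_def h_def flip: exp_add)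
  moreover have "\<forall>\<^sub>F s in nhds \<tau>. exp_average c \<phi> s = exp (c * s) * (?J - integral {a..s} h)"
  proof -
    have "\<forall>\<^sub>F s in nhds \<tau>. s \<in> {a<..}"
      by (rule eventually_nhds_in_open) (auto simp: a_def)
    then show ?thesis
      by eventually_elim (use tail(2) split in auto)
  qed
  ultimately show ?thesis
    by (subst DERIV_cong_ev[OF refl _ refl]) auto
qed

text \<open>One term of the exponential series with nonnegative terms is at most the sum.\<close>

lemma power_le_fact_exp:
  fixes x :: real
  assumes "0 \<le> x"
  shows "x ^ k \<le> fact k * exp x"
proof -
  have "(\<Sum>n\<in>{k}. inverse (fact n) *\<^sub>R x ^ n) \<le> (\<Sum>n. inverse (fact n) *\<^sub>R x ^ n)"
    by (rule sum_le_suminf[OF summable_exp_generic]) (use assms in auto)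
  then show ?thesis
    by (simp add: exp_def field_simps)
qed

text \<open>With s = t - \<tau>, powers of \<tau> are bounded by powers of t plus powers of s. The
  former are absorbed by the decay of \<phi>, the latter by half of the exponential rate; the other
  half keeps the integral finite.\<close>

lemma exp_average_bound:
  assumes "0 < c" "schwartz \<phi>"
  shows "\<exists>C. \<forall>\<tau>. \<bar>\<tau> ^ k * exp_average c \<phi> \<tau>\<bar> \<le> C"
proof -
  \<comment> \<open>From \<open>power_le_fact_exp\<close> at \<open>c / 2 * s\<close>: this is the
    price of trading \<open>s ^ k\<close> for \<open>exp (c / 2 * s)\<close>.\<close>
  define B where "B = fact k * (2 / c) ^ k"
  have B: "s ^ k * exp (- c * s) \<le> B * exp (- (c / 2) * s)" if "0 \<le> s" for s
  proof -
    have "(c / 2 * s) ^ k \<le> fact k * exp (c / 2 * s)"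
      using that assms by (intro power_le_fact_exp) auto
    then have "(2 / c) ^ k * (c / 2 * s) ^ k \<le> (2 / c) ^ k * (fact k * exp (c / 2 * s))"
      using assms by (intro mult_left_mono) auto
    then have "s ^ k \<le> B * exp (c / 2 * s)"
      using assms by (simp add: B_def mult_ac flip: power_mult_distrib)
    then have "s ^ k * exp (- c * s) \<le> B * exp (c / 2 * s) * exp (- c * s)"
      by (intro mult_right_mono) auto
    also have "\<dots> = B * exp (- (c / 2) * s)"
      by (simp add: mult.assoc flip: exp_add)
    finally show ?thesis .
  qed
  have B0: "0 \<le> B"
    using assms by (simp add: B_def)
  let ?p = "\<lambda>k. schwartz_seminorm k 0 \<phi>"
  define D where "D = 2 ^ k * (?p k + ?p 0 * B)"
  have "\<bar>\<tau> ^ k * exp_average c \<phi> \<tau>\<bar> \<le> D * (1 / (c / 2))" for \<tau>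
  proof -
    have pointwise: "\<bar>\<tau> ^ k * (exp (- c * (t - \<tau>)) * \<phi> t)\<bar> \<le> D * exp (- (c / 2) * (t - \<tau>))"
      if "\<tau> < t" for t
    proof -
      define s where "s = t - \<tau>"
      have s: "0 < s" using that by (simp add: s_def)
      have "\<bar>\<tau>\<bar> ^ k \<le> (2 * max \<bar>t\<bar> s) ^ k"
        using s by (intro power_mono) (auto simp: s_def max_def abs_if)
      also have "\<dots> \<le> 2 ^ k * (\<bar>t\<bar> ^ k + s ^ k)"
        using s by (auto simp: power_mult_distrib max_def)
      finally have tau: "\<bar>\<tau>\<bar> ^ k \<le> 2 ^ k * (\<bar>t\<bar> ^ k + s ^ k)" .
      have "\<bar>\<tau> ^ k * (exp (- c * s) * \<phi> t)\<bar> = \<bar>\<tau>\<bar> ^ k * (exp (- c * s) * \<bar>\<phi> t\<bar>)"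
        by (simp add: abs_mult power_abs)
      also have "\<dots> \<le> 2 ^ k * (\<bar>t\<bar> ^ k + s ^ k) * (exp (- c * s) * \<bar>\<phi> t\<bar>)"
        by (intro mult_right_mono tau) auto
      also have "\<dots> = 2 ^ k * ((\<bar>t\<bar> ^ k * \<bar>\<phi> t\<bar>) * exp (- c * s) + \<bar>\<phi> t\<bar> * (s ^ k * exp (- c * s)))"
        by (simp add: algebra_simps)
      also have "\<dots> \<le> 2 ^ k * (?p k * exp (- (c / 2) * s) + ?p 0 * (B * exp (- (c / 2) * s)))"
      proof (intro mult_left_mono add_mono)
        have e: "exp (- c * s) \<le> exp (- (c / 2) * s)"
          using assms s by simp
        have p: "\<bar>t\<bar> ^ k * \<bar>\<phi> t\<bar> \<le> ?p k" "\<bar>\<phi> t\<bar> \<le> ?p 0"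
          using seminorm_upper[OF assms(2), of t k 0] seminorm_upper[OF assms(2), of t 0 0]
          by (auto simp: abs_mult power_abs)
        show "\<bar>t\<bar> ^ k * \<bar>\<phi> t\<bar> * exp (- c * s) \<le> ?p k * exp (- (c / 2) * s)"
          by (rule mult_mono[OF p(1) e]) (simp_all add: seminorm_nonneg[OF assms(2)])
        show "\<bar>\<phi> t\<bar> * (s ^ k * exp (- c * s)) \<le> ?p 0 * (B * exp (- (c / 2) * s))"
          using s by (intro mult_mono[OF p(2) B]) (simp_all add: seminorm_nonneg[OF assms(2)])
      qed simp
      also have "\<dots> = D * exp (- (c / 2) * s)"
        by (simp add: D_def algebra_simps)
      finally show ?thesis
        by (simp add: s_def)
    qed
    have "\<tau> ^ k * exp_average c \<phi> \<tau> = (LINT t:{\<tau><..}|lborel. \<tau> ^ k * (exp (- c * (t - \<tau>)) * \<phi> t))"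
      by (simp only: exp_average_def set_integral_mult_right)
    also have "norm \<dots> \<le> (LINT t:{\<tau><..}|lborel. norm (\<tau> ^ k * (exp (- c * (t - \<tau>)) * \<phi> t)))"
      by (intro set_integral_norm_bound set_integrable_mult_right exp_average_integrable assms)
    also have "\<dots> \<le> (LINT t:{\<tau><..}|lborel. D * exp (- (c / 2) * (t - \<tau>)))"
      unfolding real_norm_def using pointwise assms
      by (intro set_integral_mono set_integrable_abs set_integrable_mult_right
          exp_average_integrable exp_tail) auto
    also have "\<dots> = D * (1 / (c / 2))"
      using exp_tail(2)[of "c / 2" \<tau>] assms by (simp only: set_integral_mult_right half_gt_zero_iff)
    finally show ?thesis
      by simp
  qed
  then show ?thesis
    by blast
qed

lemma schwartz_exp_average:
  assumes "0 < c" "schwartz \<phi>"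
  shows "schwartz (exp_average c \<phi>)"
proof (rule schwartz_coinduct)
  show "exp_average c \<phi> \<in> {exp_average c f |f. schwartz f}"
    using assms by blast
next
  fix h x assume "h \<in> {exp_average c f |f. schwartz f}"
  then show "h differentiable (at x)"
    using exp_average_has_derivative[OF assms(1)] by (auto simp: real_differentiable_def)
next
  fix h assume "h \<in> {exp_average c f |f. schwartz f}"
  then obtain f where f: "h = exp_average c f" "schwartz f"
    by blast
  then have "deriv h = exp_average c (deriv f)"
    using exp_average_has_derivative[OF assms(1) f(2)] by (intro ext DERIV_imp_deriv) simp
  then show "deriv h \<in> {exp_average c f |f. schwartz f}"
    using schwartz_deriv f(2) by blast
next
  fix h and k :: nat assume "h \<in> {exp_average c f |f. schwartz f}"
  then show "\<exists>C. \<forall>x. \<bar>x ^ k * h x\<bar> \<le> C"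
    using exp_average_bound[OF assms(1)] by blast
qed

text \<open>Both directions only substitute a test function, c phi - phi' in one and K phi in the
  other. Hence the identity is needed in both orders, while \<open>u\<close> and \<open>v\<close>
  may be arbitrary functionals.\<close>

lemma cf_distribution_eq_iff:
  assumes "M \<alpha> \<noteq> 0" "0 < \<alpha>" "\<alpha> < 1"
  defines "c \<equiv> \<alpha> / (1 - \<alpha>)"
  shows "dist_eq (cf_distribution M \<alpha> u) v \<longleftrightarrow>
    dist_eq u (\<lambda>\<phi>. (1 - \<alpha>) / M \<alpha> * v (\<lambda>t. c * \<phi> t - deriv \<phi> t))"
proof -
  have c: "0 < c"
    using assms by (simp add: c_def)
  have cf: "cf_distribution M \<alpha> u \<phi> = M \<alpha> / (1 - \<alpha>) * u (exp_average c \<phi>)" for \<phi>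
    by (simp add: cf_distribution_def exp_average_def[abs_def] c_def)
  show ?thesis
  proof
    assume *: "dist_eq (cf_distribution M \<alpha> u) v"
    show "dist_eq u (\<lambda>\<phi>. (1 - \<alpha>) / M \<alpha> * v (\<lambda>t. c * \<phi> t - deriv \<phi> t))"
      unfolding dist_eq_def
    proof (intro allI impI)
      fix \<phi> assume \<phi>: "schwartz \<phi>"
      have "schwartz (\<lambda>t. c * \<phi> t - deriv \<phi> t)"
        using schwartz_lincomb[OF \<phi> schwartz_deriv[OF \<phi>], of c "-1"] by simp
      then have "M \<alpha> / (1 - \<alpha>) * u (exp_average c (\<lambda>t. c * \<phi> t - deriv \<phi> t)) =
          v (\<lambda>t. c * \<phi> t - deriv \<phi> t)"
        using * by (simp add: dist_eq_def cf)
      moreover have "exp_average c (\<lambda>t. c * \<phi> t - deriv \<phi> t) = \<phi>"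
        using exp_average_inverse[OF c \<phi>] by blast
      ultimately show "u \<phi> = (1 - \<alpha>) / M \<alpha> * v (\<lambda>t. c * \<phi> t - deriv \<phi> t)"
        using assms by (simp add: field_simps)
    qed
  next
    assume *: "dist_eq u (\<lambda>\<phi>. (1 - \<alpha>) / M \<alpha> * v (\<lambda>t. c * \<phi> t - deriv \<phi> t))"
    show "dist_eq (cf_distribution M \<alpha> u) v"
      unfolding dist_eq_def
    proof (intro allI impI)
      fix \<phi> assume \<phi>: "schwartz \<phi>"
      have "deriv (exp_average c \<phi>) t = c * exp_average c \<phi> t - \<phi> t" for t
        using DERIV_imp_deriv[OF exp_average_has_derivative[OF c \<phi>]] exp_average_deriv[OF c \<phi>]
        by simp
      then have "u (exp_average c \<phi>) = (1 - \<alpha>) / M \<alpha> * v \<phi>"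
        using * schwartz_exp_average[OF c \<phi>] by (simp add: dist_eq_def)
      then show "cf_distribution M \<alpha> u \<phi> = v \<phi>"
        using assms by (simp add: cf)
    qed
  qed
qed

section \<open>Tempered functions and primitives on the half line\<close>

lemma tempered_set_integrable:
  assumes "tempered_fun f" "0 \<le> b"
  shows "set_integrable lborel {0<..<b} f"
proof -
  obtain N :: nat where "set_integrable lborel {0<..} (\<lambda>t. f t / (1 + t) ^ N)"
    using assms(1) tempered_fun_def by blast
  then have N: "set_integrable lborel {0<..<b} (\<lambda>t. f t / (1 + t) ^ N)"
    by (rule set_integrable_subset) auto
  have [measurable]: "(\<lambda>t. indicator {0<..<b} t *\<^sub>R (f t / (1 + t) ^ N)) \<in> borel_measurable lborel"
    using N unfolding set_integrable_def by (rule borel_measurable_integrable)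
  show ?thesis
  proof (rule set_integrable_bound)
    show "set_integrable lborel {0<..<b} (\<lambda>t. (1 + b) ^ N * (f t / (1 + t) ^ N))"
      by (intro set_integrable_mult_right N)
    have "(\<lambda>t. indicator {0<..<b} t *\<^sub>R f t) =
        (\<lambda>t. indicator {0<..<b} t *\<^sub>R (f t / (1 + t) ^ N) * (1 + t) ^ N)"
      by (intro ext) (simp add: indicator_def)
    moreover have "\<dots> \<in> borel_measurable lborel"
      by measurable
    ultimately show "set_borel_measurable lborel {0<..<b} f"
      by (simp only: set_borel_measurable_def)
    show "AE t in lborel. t \<in> {0<..<b} \<longrightarrow> norm (f t) \<le> norm ((1 + b) ^ N * (f t / (1 + t) ^ N))"
    proof (intro AE_I2 impI)
      fix t assume t: "t \<in> {0<..<b}"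
      have "norm (f t) = (1 + t) ^ N * \<bar>f t / (1 + t) ^ N\<bar>"
        using t by simp
      also have "\<dots> \<le> (1 + b) ^ N * \<bar>f t / (1 + t) ^ N\<bar>"
        using t by (intro mult_right_mono power_mono) auto
      finally show "norm (f t) \<le> norm ((1 + b) ^ N * (f t / (1 + t) ^ N))"
        using assms by (simp add: abs_mult)
    qed
  qed
qed

lemma tempered_fun_mult_left:
  assumes "tempered_fun f"
  shows "tempered_fun (\<lambda>t. a * f t)"
proof -
  obtain N :: nat where "set_integrable lborel {0<..} (\<lambda>t. f t / (1 + t) ^ N)"
    using assms tempered_fun_def by blast
  then have "set_integrable lborel {0<..} (\<lambda>t. a * (f t / (1 + t) ^ N))"
    by (rule set_integrable_mult_right)
  then show ?thesis
    unfolding tempered_fun_def by auto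
qed

lemma tempered_fun_weight_mono:
  assumes "set_integrable lborel {0<..} (\<lambda>t::real. f t / (1 + t) ^ m :: real)" "m \<le> n"
  shows "set_integrable lborel {0<..} (\<lambda>t. f t / (1 + t) ^ n)"
proof (rule set_integrable_bound[OF assms(1)])
  have eq: "(1 + t) ^ n = (1 + t) ^ m * (1 + t) ^ (n - m)" for t :: real
    using assms(2) by (simp flip: power_add)
  have [measurable]: "(\<lambda>t. indicator {0<..} t *\<^sub>R (f t / (1 + t) ^ m)) \<in> borel_measurable lborel"
    using assms(1) unfolding set_integrable_def by (rule borel_measurable_integrable)
  have "(\<lambda>t. indicator {0<..} t *\<^sub>R (f t / (1 + t) ^ n)) =
      (\<lambda>t. indicator {0<..} t *\<^sub>R (f t / (1 + t) ^ m) * (1 / (1 + t) ^ (n - m)))"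
    by (intro ext) (simp add: eq)
  moreover have "\<dots> \<in> borel_measurable lborel"
    by measurable
  ultimately show "set_borel_measurable lborel {0<..} (\<lambda>t. f t / (1 + t) ^ n)"
    by (simp only: set_borel_measurable_def)
  show "AE t in lborel. t \<in> {0<..} \<longrightarrow> norm (f t / (1 + t) ^ n) \<le> norm (f t / (1 + t) ^ m)"
  proof (intro AE_I2 impI)
    fix t :: real assume "t \<in> {0<..}"
    then have t: "0 < t" by simp
    then have "(1 + t) ^ m \<le> (1 + t) ^ n"
      using assms(2) by (intro power_increasing) auto
    then have "\<bar>f t\<bar> / (1 + t) ^ n \<le> \<bar>f t\<bar> / (1 + t) ^ m"
      using t by (intro divide_left_mono mult_pos_pos zero_less_power) auto
    then show "norm (f t / (1 + t) ^ n) \<le> norm (f t / (1 + t) ^ m)"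
      using t by simp
  qed
qed

lemma tempered_fun_diff:
  assumes "tempered_fun f" "tempered_fun g"
  shows "tempered_fun (\<lambda>t. f t - g t)"
proof -
  obtain m n where "set_integrable lborel {0<..} (\<lambda>t. f t / (1 + t) ^ m)"
    "set_integrable lborel {0<..} (\<lambda>t. g t / (1 + t) ^ n)"
    using assms unfolding tempered_fun_def by blast
  then have "set_integrable lborel {0<..} (\<lambda>t. f t / (1 + t) ^ max m n)"
    "set_integrable lborel {0<..} (\<lambda>t. g t / (1 + t) ^ max m n)"
    by (simp_all only: tempered_fun_weight_mono max.cobounded1 max.cobounded2)
  then have "set_integrable lborel {0<..} (\<lambda>t. (f t - g t) / (1 + t) ^ max m n)"
    unfolding diff_divide_distrib by (rule set_integral_diff)
  then show ?thesis
    unfolding tempered_fun_def by blast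
qed

lemma tempered_fun_polynomial_growth:
  assumes "continuous_on {0<..} f" "\<And>t. 0 < t \<Longrightarrow> \<bar>f t\<bar> \<le> C * (1 + t) ^ N"
  shows "tempered_fun f"
proof -
  have D: "((\<lambda>t. - 1 / (1 + t)) has_field_derivative 1 / (1 + t) ^ 2) (at t)" if "0 < t" for t :: real
    using that by (auto intro!: derivative_eq_intros simp: power2_eq_square)
  have lim0: "((\<lambda>t::real. - 1 / (1 + t)) \<longlongrightarrow> - 1) (at_right 0)"
    by real_asymp
  have lim1: "((\<lambda>t::real. - 1 / (1 + t)) \<longlongrightarrow> 0) at_top"
    by real_asymp
  have "set_integrable lborel (einterval (ereal 0) \<infinity>) (\<lambda>t. 1 / (1 + t) ^ 2)"
    using D lim0 lim1
    by (intro interval_integral_FTC_nonneg(1)[where F = "\<lambda>t. - 1 / (1 + t)" and A = "-1" and B = 0])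
      (auto simp: ereal_tendsto_simps zero_ereal_def intro!: continuous_intros)
  then have I: "set_integrable lborel {0<..} (\<lambda>t. C * (1 / (1 + t :: real) ^ 2))"
    by (intro set_integrable_mult_right) simp
  \<comment> \<open>Two powers more than the growth leave \<open>1 / (1 + t) ^ 2\<close>, which is
    integrable with primitive \<open>- 1 / (1 + t)\<close>.\<close>
  have "set_integrable lborel {0<..} (\<lambda>t. f t / (1 + t) ^ (N + 2))"
  proof (rule set_integrable_bound[OF I])
    have "continuous_on {0<..} (\<lambda>t. f t / (1 + t) ^ (N + 2))"
      by (intro continuous_intros assms) auto
    from set_measurable_continuous_on[OF _ this]
    show "set_borel_measurable lborel {0<..} (\<lambda>t. f t / (1 + t) ^ (N + 2))"
      by (simp add: set_borel_measurable_def)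
    show "AE t in lborel. t \<in> {0<..} \<longrightarrow> norm (f t / (1 + t) ^ (N + 2)) \<le> norm (C * (1 / (1 + t) ^ 2))"
    proof (intro AE_I2 impI)
      fix t :: real assume "t \<in> {0<..}"
      then have t: "0 < t" by simp
      have "norm (f t / (1 + t) ^ (N + 2)) = \<bar>f t\<bar> / (1 + t) ^ (N + 2)"
        using t by simp
      also have "\<dots> \<le> C * (1 + t) ^ N / (1 + t) ^ (N + 2)"
        using t assms(2) by (intro divide_right_mono) auto
      also have "\<dots> = C * (1 / (1 + t) ^ 2)"
        using t by (simp add: power_add power2_eq_square)
      finally show "norm (f t / (1 + t) ^ (N + 2)) \<le> norm (C * (1 / (1 + t) ^ 2))"
        by (simp only: real_norm_def)
    qed
  qed
  then show ?thesis
    unfolding tempered_fun_def by blast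
qed

section \<open>Primitives and integration by parts up to the endpoint 0\<close>

lemma has_integral_set_integral:
  fixes f :: "real \<Rightarrow> real"
  assumes "set_integrable lborel S f"
  shows "(f has_integral (LINT t:S|lborel. f t)) S"
  unfolding set_borel_integral_eq_integral(2)[OF assms]
  by (rule integrable_integral[OF set_borel_integral_eq_integral(1)[OF assms]])

text \<open>Intended for integrands built from \<open>deriv y\<close>, which is integrable but not
  known to be continuous. The gauge integral version of the fundamental theorem asks only for
  derivatives in the interior, and integrability identifies its value with the Lebesgue
  integral.\<close>

lemma set_integral_FTC:
  fixes F f :: "real \<Rightarrow> real"
  assumes "a < b" "set_integrable lborel {a<..<b} f"
    and D: "\<And>t. a < t \<Longrightarrow> (F has_field_derivative f t) (at t)"
    and lim: "(F \<longlongrightarrow> A) (at_right a)"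
  shows "(LINT t:{a<..<b}|lborel. f t) = F b - A"
proof -
  \<comment> \<open>\<open>F\<close> need not be continuous at \<open>a\<close>; putting in the
    right limit \<open>A\<close> there makes the function continuous on the closed interval.\<close>
  define G where "G t = (if t \<le> a then A else F t)" for t
  have Ga: "G a = A" and Gb: "G b = F b"
    using assms(1) by (simp_all add: G_def)
  have G: "\<forall>\<^sub>F s in nhds t. G s = F s" if "a < t" for t
    by (rule eventually_mono[OF eventually_nhds_in_open[of "{a<..}"]]) (use that in \<open>auto simp: G_def\<close>)
  have D': "(G has_field_derivative f t) (at t)" if "a < t" for t
    unfolding DERIV_cong_ev[OF refl G[OF that] refl] by (rule D[OF that])
  have Gcont: "(G \<longlongrightarrow> G t) (at t)" if "a < t" for t
    using DERIV_isCont[OF D'[OF that]] by (simp only: isCont_def)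
  have "(G \<longlongrightarrow> G a) (at_right a)"
    unfolding Ga by (rule Lim_transform_eventually[OF lim]) (simp add: eventually_at_filter G_def)
  moreover have "(G \<longlongrightarrow> G b) (at_left b)"
    by (rule tendsto_mono[OF _ Gcont[OF assms(1)]]) (simp add: at_le)
  ultimately have "continuous_on {a..b} G"
    using Gcont assms(1) by (intro continuous_on_IccI) simp_all
  then have "(f has_integral G b - G a) {a..b}"
    using assms(1) D'
    by (intro fundamental_theorem_of_calculus_interior)
      (auto simp: has_real_derivative_iff_has_vector_derivative)
  then have "(f has_integral F b - A) {a<..<b}"
    unfolding Ga Gb by (rule iffD1[OF has_integral_Icc_iff_Ioo])
  with has_integral_set_integral[OF assms(2)] show ?thesis
    by (rule has_integral_unique)
qed

text \<open>\<open>f\<close> may be unbounded near \<open>a\<close>. The derivative is therefore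
  computed from a base point inside the interval, and the limit at \<open>a\<close> from convergence
  of the integrals over \<open>{t..b}\<close> as t tends to \<open>a\<close>.\<close>

lemma primitive:
  fixes f :: "real \<Rightarrow> real"
  assumes cont: "continuous_on {a<..} f" and int: "\<And>b. a < b \<Longrightarrow> set_integrable lborel {a<..<b} f"
  defines "F \<equiv> \<lambda>t. LINT s:{a<..<t}|lborel. f s"
  shows "a < t \<Longrightarrow> (F has_field_derivative f t) (at t)" and "(F \<longlongrightarrow> 0) (at_right a)"
proof -
  have split: "F t = F b - integral {t..b} f" if "a < t" "t < b" for t b
  proof -
    have "set_integrable lborel {t..b} f"
      using that by (intro borel_integrable_atLeastAtMost' continuous_on_subset[OF cont]) auto
    from set_borel_integral_eq_integral(2)[OF this]
    have 1: "integral {t..b} f = (LINT s:{t..<b}|lborel. f s)"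
      by (subst (asm) set_integral_discrete_difference[where X = "{b}" and B = "{t..<b}"]) auto
    have "F b = (LINT s:{a<..<t} \<union> {t..<b}|lborel. f s)"
      unfolding F_def using that
      by (intro arg_cong2[where f = "\<lambda>A f. set_lebesgue_integral lborel A f"]) auto
    also have "\<dots> = F t + (LINT s:{t..<b}|lborel. f s)"
      unfolding F_def using that int[of b]
      by (intro set_integral_Un) (auto elim!: set_integrable_subset)
    finally show ?thesis
      using 1 by simp
  qed
  show "(F has_field_derivative f t) (at t)" if t: "a < t" for t
  proof -
    \<comment> \<open>A compact neighbourhood of \<open>t\<close> that stays away from
      \<open>a\<close>, on which \<open>f\<close> is continuous.\<close>
    define l u where "l = (a + t) / 2" and "u = t + 1"
    have lu: "a < l" "l < t" "t < u"
      using t by (auto simp: l_def u_def field_simps)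
    have cont_lu: "continuous_on {l..u} f"
      using lu by (intro continuous_on_subset[OF cont]) auto
    have "((\<lambda>s. integral {l..s} f) has_field_derivative f t) (at t within {l..u})"
      using lu by (intro integral_has_real_derivative[OF cont_lu]) auto
    then have "((\<lambda>s. integral {l..s} f) has_field_derivative f t) (at t)"
      by (subst (asm) at_within_Icc_at) (use lu in auto)
    then have *: "((\<lambda>s. F l + integral {l..s} f) has_field_derivative f t) (at t)"
      by (auto intro!: derivative_eq_intros)
    have "\<forall>\<^sub>F s in nhds t. s \<in> {l<..}"
      using lu by (intro eventually_nhds_in_open) auto
    then have "\<forall>\<^sub>F s in nhds t. F l + integral {l..s} f = F s"
      by eventually_elim (use split[OF lu(1)] in auto)
    from DERIV_cong_ev[OF refl this refl] * show ?thesis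
      by blast
  qed
  show "(F \<longlongrightarrow> 0) (at_right a)"
  proof -
    define b where "b = a + 1"
    have ab: "a < b" by (simp add: b_def)
    have ext: "set_integrable lborel {a<..b} f"
      using int[of "b + 1"] ab by (auto elim!: set_integrable_subset)
    have "((\<lambda>t. LINT s:{t..b}|lborel. f s) \<longlongrightarrow> (LINT s:{a<..b}|lborel. f s)) (at_right a)"
      by (rule tendsto_set_lebesgue_integral_at_right[OF ab _ ext]) auto
    also have "(LINT s:{a<..b}|lborel. f s) = F b"
      unfolding F_def by (intro set_integral_discrete_difference[where X = "{b}"]) auto
    finally have "((\<lambda>t. F b - (LINT s:{t..b}|lborel. f s)) \<longlongrightarrow> F b - F b) (at_right a)"
      by (intro tendsto_intros)
    moreover have "\<forall>\<^sub>F t in at_right a. F b - (LINT s:{t..b}|lborel. f s) = F t"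
    proof -
      have "\<forall>\<^sub>F t in at_right a. t \<in> {a<..<b}"
        using ab eventually_at_right_real by blast
      then show ?thesis
      proof eventually_elim
        case (elim t)
        then have "set_integrable lborel {t..b} f"
          by (intro borel_integrable_atLeastAtMost' continuous_on_subset[OF cont]) auto
        then show ?case
          using elim split[of t b] by (simp add: set_borel_integral_eq_integral)
      qed
    qed
    ultimately show ?thesis
      using Lim_transform_eventually by fastforce
  qed
qed

text \<open>For s < t the weight at s is at most the weight at t, so the weighted L1 norm of
  \<open>f\<close> serves as \<open>C\<close>.\<close>

lemma primitive_growth:
  assumes "tempered_fun f"
  obtains C N where "\<And>t. 0 < t \<Longrightarrow> \<bar>LINT s:{0<..<t}|lborel. f s\<bar> \<le> C * (1 + t) ^ N"
proof -
  obtain N :: nat where N: "set_integrable lborel {0<..} (\<lambda>t. f t / (1 + t) ^ N)"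
    using assms(1) tempered_fun_def by blast
  have "\<bar>LINT s:{0<..<t}|lborel. f s\<bar> \<le> (LINT s:{0<..}|lborel. \<bar>f s / (1 + s) ^ N\<bar>) * (1 + t) ^ N"
    if t: "0 < t" for t
  proof -
    have int: "set_integrable lborel {0<..<t} f"
      using tempered_set_integrable[OF assms] t by simp
    have "\<bar>LINT s:{0<..<t}|lborel. f s\<bar> \<le> (LINT s:{0<..<t}|lborel. \<bar>f s\<bar>)"
      using set_integral_norm_bound[OF int] by simp
    also have "\<dots> \<le> (LINT s:{0<..}|lborel. \<bar>f s / (1 + s) ^ N\<bar> * (1 + t) ^ N)"
      unfolding set_lebesgue_integral_def
    proof (rule integral_mono)
      show "integrable lborel (\<lambda>s. indicator {0<..<t} s *\<^sub>R \<bar>f s\<bar>)"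
        using set_integrable_abs[OF int] by (simp add: set_integrable_def)
      show "integrable lborel (\<lambda>s. indicator {0<..} s *\<^sub>R (\<bar>f s / (1 + s) ^ N\<bar> * (1 + t) ^ N))"
        using set_integrable_mult_left[OF set_integrable_abs[OF N], of "(1 + t) ^ N"]
        by (simp only: set_integrable_def)
      fix s
      have "\<bar>f s\<bar> \<le> \<bar>f s / (1 + s) ^ N\<bar> * (1 + t) ^ N" if s: "0 < s" "s < t"
      proof -
        have "\<bar>f s\<bar> = \<bar>f s / (1 + s) ^ N\<bar> * (1 + s) ^ N"
          using s by simp
        also have "\<dots> \<le> \<bar>f s / (1 + s) ^ N\<bar> * (1 + t) ^ N"
          using s by (intro mult_left_mono power_mono) auto
        finally show ?thesis .
      qed
      then show "indicator {0<..<t} s *\<^sub>R \<bar>f s\<bar> \<le>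
          indicator {0<..} s *\<^sub>R (\<bar>f s / (1 + s) ^ N\<bar> * (1 + t) ^ N)"
        using t by (auto simp: indicator_def)
    qed
    also have "\<dots> = (LINT s:{0<..}|lborel. \<bar>f s / (1 + s) ^ N\<bar>) * (1 + t) ^ N"
      by (rule set_integral_mult_left)
    finally show ?thesis .
  qed
  then show thesis
    by (rule that)
qed

text \<open>The jump formula: \<open>z\<close> extended by 0 has the distributional derivative z' +
  z0 \<delta>. It is the fundamental theorem on the half line for the product of \<open>z\<close>
  and \<phi>.\<close>

lemma regular_dist_by_parts:
  assumes D: "\<And>t. 0 < t \<Longrightarrow> (z has_field_derivative z' t) (at t)"
    and cont: "continuous_on {0<..} z'" and temp: "tempered_fun z'"
    and growth: "\<And>t. 0 < t \<Longrightarrow> \<bar>z t\<bar> \<le> C * (1 + t) ^ N"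
    and lim: "(z \<longlongrightarrow> z0) (at_right 0)" and \<phi>: "schwartz \<phi>"
  shows "regular_dist z' \<phi> = - regular_dist z (deriv \<phi>) - z0 * \<phi> 0"
proof -
  have z: "tempered_fun z"
    using D growth by (intro tempered_fun_polynomial_growth[of z C N] continuous_at_imp_continuous_on)
      (auto intro: DERIV_isCont)
  have int: "set_integrable lborel {0<..} (\<lambda>t. z' t * \<phi> t)"
    "set_integrable lborel {0<..} (\<lambda>t. z t * deriv \<phi> t)"
    by (intro tempered_schwartz_integrable temp z \<phi> schwartz_deriv)+
  have "(LINT t:{0<..}|lborel. z' t * \<phi> t + z t * deriv \<phi> t) = 0 - z0 * \<phi> 0"
  proof (rule half_line_FTC)
    show "((\<lambda>t. z t * \<phi> t) has_field_derivative z' t * \<phi> t + z t * deriv \<phi> t) (at t)" if "0 < t" for t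
      by (auto intro!: derivative_eq_intros D schwartz_has_derivative that \<phi>)
    show "isCont (\<lambda>t. z' t * \<phi> t + z t * deriv \<phi> t) t" if "0 < t" for t
    proof -
      have "isCont z' t" "isCont z t"
        using cont that DERIV_isCont[OF D[OF that]] by (auto simp: continuous_on_eq_continuous_at)
      then show ?thesis
        by (intro continuous_intros schwartz_isCont[OF \<phi>] schwartz_isCont[OF schwartz_deriv[OF \<phi>]])
    qed
    show "set_integrable lborel {0<..} (\<lambda>t. z' t * \<phi> t + z t * deriv \<phi> t)"
      by (intro set_integral_add int)
    have "(\<phi> \<longlongrightarrow> \<phi> 0) (at_right 0)"
      using schwartz_isCont[OF \<phi>, of 0] unfolding isCont_def
      by (rule tendsto_mono[rotated]) (simp add: at_le)
    then show "((\<lambda>t. z t * \<phi> t) \<longlongrightarrow> z0 * \<phi> 0) (at_right 0)"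
      by (intro tendsto_intros lim)
    \<comment> \<open>One power more than the growth of \<open>z\<close>, so that the product decays
      like \<open>1 / (1 + t)\<close>.\<close>
    define B where "B = 2 ^ Suc N * (\<Sum>k\<le>Suc N. schwartz_seminorm k 0 \<phi>)"
    show "((\<lambda>t. z t * \<phi> t) \<longlongrightarrow> 0) at_top"
    proof (rule tendsto_0_le)
      show "((\<lambda>t::real. 1 / (1 + t)) \<longlongrightarrow> 0) at_top"
        by real_asymp
      show "\<forall>\<^sub>F t in at_top. norm (z t * \<phi> t) \<le> norm (1 / (1 + t)) * (\<bar>C\<bar> * B)"
        using eventually_gt_at_top[of 0]
      proof eventually_elim
        case (elim t)
        have "norm (z t * \<phi> t) \<le> (\<bar>C\<bar> * (1 + t) ^ N) * \<bar>\<phi> t\<bar>"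
          unfolding real_norm_def abs_mult
          using elim by (intro mult_right_mono order_trans[OF growth]) auto
        also have "\<dots> = 1 / (1 + t) * (\<bar>C\<bar> * ((1 + t) ^ Suc N * \<bar>\<phi> t\<bar>))"
          using elim by (simp add: field_simps)
        also have "\<dots> \<le> 1 / (1 + t) * (\<bar>C\<bar> * B)"
          unfolding B_def using elim by (intro mult_left_mono schwartz_weight_bound \<phi>) auto
        finally show ?case
          using elim by simp
      qed
    qed
  qed
  then show ?thesis
    unfolding regular_dist_def using set_integral_add(2)[OF int] by simp
qed

section \<open>Vanishing of the distributional derivative\<close>

lemma poly_gaussian_bounded:
  fixes p :: "real poly"
  assumes "0 < a"
  shows "\<exists>C. \<forall>x. \<bar>poly p x * exp (- a * x\<^sup>2)\<bar> \<le> C"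
proof -
  \<comment> \<open>Passing from \<open>\<bar>x\<bar> ^ m\<close> to
    \<open>1 + (x\<^sup>2) ^ m\<close> makes everything a function of \<open>a * x\<^sup>2\<close>,
    where one term of the exponential series suffices.\<close>
  have monomial: "\<bar>x\<bar> ^ m * exp (- a * x\<^sup>2) \<le> 1 + fact m / a ^ m" for x :: real and m
  proof -
    have "\<bar>x\<bar> ^ m \<le> 1 + (x\<^sup>2) ^ m"
    proof (cases "\<bar>x\<bar> \<le> 1")
      case True
      then have "\<bar>x\<bar> ^ m \<le> 1" by (intro power_le_one) auto
      also have "\<dots> \<le> 1 + (x\<^sup>2) ^ m" by simp
      finally show ?thesis .
    next
      case False
      then have "\<bar>x\<bar> ^ m \<le> \<bar>x\<bar> ^ (2 * m)" by (intro power_increasing) auto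
      then show ?thesis by (simp add: power_mult)
    qed
    also have "\<dots> = 1 + (a * x\<^sup>2) ^ m / a ^ m"
      using assms by (simp add: power_mult_distrib)
    also have "\<dots> \<le> exp (a * x\<^sup>2) + fact m * exp (a * x\<^sup>2) / a ^ m"
      using assms by (intro add_mono divide_right_mono power_le_fact_exp) auto
    finally have "\<bar>x\<bar> ^ m * exp (- a * x\<^sup>2) \<le>
        (exp (a * x\<^sup>2) + fact m * exp (a * x\<^sup>2) / a ^ m) * exp (- a * x\<^sup>2)"
      by (intro mult_right_mono) auto
    also have "\<dots> = 1 + fact m / a ^ m"
      by (simp add: distrib_right exp_minus)
    finally show ?thesis .
  qed
  have "\<bar>poly p x * exp (- a * x\<^sup>2)\<bar> \<le> (\<Sum>i\<le>degree p. \<bar>coeff p i\<bar> * (1 + fact i / a ^ i))" for x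
  proof -
    have "\<bar>poly p x * exp (- a * x\<^sup>2)\<bar> = \<bar>\<Sum>i\<le>degree p. coeff p i * x ^ i * exp (- a * x\<^sup>2)\<bar>"
      by (simp add: poly_altdef sum_distrib_right)
    also have "\<dots> \<le> (\<Sum>i\<le>degree p. \<bar>coeff p i * x ^ i * exp (- a * x\<^sup>2)\<bar>)"
      by (rule sum_abs)
    also have "\<dots> = (\<Sum>i\<le>degree p. \<bar>coeff p i\<bar> * (\<bar>x\<bar> ^ i * exp (- a * x\<^sup>2)))"
      by (simp add: abs_mult power_abs mult.assoc)
    also have "\<dots> \<le> (\<Sum>i\<le>degree p. \<bar>coeff p i\<bar> * (1 + fact i / a ^ i))"
      by (intro sum_mono mult_left_mono monomial) auto
    finally show ?thesis .
  qed
  then show ?thesis by blast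
qed

lemma poly_gaussian_has_derivative:
  fixes p :: "real poly"
  shows "((\<lambda>x. poly p x * exp (- a * x\<^sup>2)) has_field_derivative
    poly (pderiv p - [:0, 2 * a:] * p) x * exp (- a * x\<^sup>2)) (at x)"
  by (auto intro!: derivative_eq_intros simp: algebra_simps)

text \<open>Derivatives of a Gaussian are Hermite-type polynomials times the Gaussian; allowing
  every polynomial factor gives a class closed under \<open>deriv\<close>.\<close>

lemma schwartz_gaussian:
  assumes "0 < a"
  shows "schwartz (\<lambda>x. exp (- a * x\<^sup>2))"
proof (rule schwartz_coinduct)
  let ?S = "{\<lambda>x. poly p x * exp (- a * x\<^sup>2) |p. True}"
  have "(\<lambda>x. exp (- a * x\<^sup>2)) = (\<lambda>x. poly [:1:] x * exp (- a * x\<^sup>2))"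
    by simp
  then show "(\<lambda>x. exp (- a * x\<^sup>2)) \<in> ?S"
    by blast
next
  fix h x assume "h \<in> {\<lambda>x. poly p x * exp (- a * x\<^sup>2) |p. True}"
  then show "h differentiable (at x)"
    using poly_gaussian_has_derivative by (auto simp: real_differentiable_def)
next
  fix h assume "h \<in> {\<lambda>x. poly p x * exp (- a * x\<^sup>2) |p. True}"
  then obtain p where "h = (\<lambda>x. poly p x * exp (- a * x\<^sup>2))"
    by blast
  then have "deriv h = (\<lambda>x. poly (pderiv p - [:0, 2 * a:] * p) x * exp (- a * x\<^sup>2))"
    by (intro ext) (simp only: DERIV_imp_deriv[OF poly_gaussian_has_derivative])
  then show "deriv h \<in> {\<lambda>x. poly p x * exp (- a * x\<^sup>2) |p. True}"
    by blast
next
  fix h and k :: nat assume "h \<in> {\<lambda>x. poly p x * exp (- a * x\<^sup>2) |p. True}"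
  then obtain p where h: "h = (\<lambda>x. poly p x * exp (- a * x\<^sup>2))"
    by blast
  have "x ^ k * h x = poly (monom 1 k * p) x * exp (- a * x\<^sup>2)" for x
    by (simp add: h poly_monom)
  then show "\<exists>C. \<forall>x. \<bar>x ^ k * h x\<bar> \<le> C"
    using poly_gaussian_bounded[OF assms, of "monom 1 k * p"] by simp
qed

text \<open>Vanishing moments mean that \<open>v\<close> annihilates all polynomials in \<xi>. By
  Weierstrass, \<open>Q\<close> is uniformly close to a polynomial on \<open>{0..1}\<close>, and the
  error in the integral is at most \<open>e\<close> times the L1 norm of \<open>v\<close>.\<close>

lemma moment_zero_imp_zero:
  fixes v \<xi> :: "real \<Rightarrow> real"
  assumes v: "set_integrable lborel S v"
    and range: "\<And>t. t \<in> S \<Longrightarrow> \<xi> t \<in> {0..1}" and [measurable]: "\<xi> \<in> borel_measurable borel"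
    and int: "\<And>n. set_integrable lborel S (\<lambda>t. v t * \<xi> t ^ n)"
    and moments: "\<And>n. (LINT t:S|lborel. v t * \<xi> t ^ n) = 0"
    and Q: "continuous_on UNIV Q"
  shows "set_integrable lborel S (\<lambda>t. v t * Q (\<xi> t))" and "(LINT t:S|lborel. v t * Q (\<xi> t)) = 0"
proof -
  have [measurable]: "Q \<in> borel_measurable borel"
    using Q by (rule borel_measurable_continuous_onI)
  have [measurable]: "(\<lambda>t. indicator S t *\<^sub>R v t) \<in> borel_measurable lborel"
    using v unfolding set_integrable_def by (rule borel_measurable_integrable)
  have "compact (Q ` {0..1})"
    using Q continuous_on_subset by (intro compact_continuous_image) auto
  then obtain B where B: "\<And>x. x \<in> {0..1} \<Longrightarrow> norm (Q x) \<le> B"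
    using compact_imp_bounded bounded_iff by (metis imageI)
  show vQ: "set_integrable lborel S (\<lambda>t. v t * Q (\<xi> t))"
  proof (rule set_integrable_bound)
    show "set_integrable lborel S (\<lambda>t. v t * B)"
      by (intro set_integrable_mult_left v)
    have "(\<lambda>t. indicator S t *\<^sub>R v t * Q (\<xi> t)) \<in> borel_measurable lborel"
      by measurable
    then show "set_borel_measurable lborel S (\<lambda>t. v t * Q (\<xi> t))"
      by (simp add: set_borel_measurable_def mult.assoc)
    show "AE t in lborel. t \<in> S \<longrightarrow> norm (v t * Q (\<xi> t)) \<le> norm (v t * B)"
    proof (intro AE_I2 impI)
      fix t assume "t \<in> S"
      then have "\<bar>Q (\<xi> t)\<bar> \<le> \<bar>B\<bar>"
        using B[OF range] by fastforce
      then show "norm (v t * Q (\<xi> t)) \<le> norm (v t * B)"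
        by (simp add: abs_mult mult_left_mono)
    qed
  qed
  have poly0: "set_integrable lborel S (\<lambda>t. v t * (\<Sum>i\<le>n. a i * \<xi> t ^ i)) \<and>
      (LINT t:S|lborel. v t * (\<Sum>i\<le>n. a i * \<xi> t ^ i)) = 0" for a :: "nat \<Rightarrow> real" and n
  proof (induction n)
    case 0
    then show ?case
      using v moments[of 0] by simp
  next
    case (Suc n)
    have *: "v t * (\<Sum>i\<le>Suc n. a i * \<xi> t ^ i) =
        v t * (\<Sum>i\<le>n. a i * \<xi> t ^ i) + a (Suc n) * (v t * \<xi> t ^ Suc n)" for t
      by (simp add: algebra_simps)
    have "set_integrable lborel S (\<lambda>t. a (Suc n) * (v t * \<xi> t ^ Suc n))"
      by (intro set_integrable_mult_right int)
    from set_integral_add[OF conjunct1[OF Suc] this] show ?case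
      unfolding * using Suc moments[of "Suc n"] by (simp only: set_integral_mult_right) simp
  qed
  define J where "J = (LINT t:S|lborel. \<bar>v t\<bar>)"
  have J: "0 \<le> J"
    unfolding J_def set_lebesgue_integral_def
    by (rule integral_nonneg_AE) (auto simp: indicator_def)
  have small: "\<bar>LINT t:S|lborel. v t * Q (\<xi> t)\<bar> \<le> e * J" if e: "0 < e" for e
  proof -
    obtain P where P: "real_polynomial_function P" "\<And>x. x \<in> {0..1} \<Longrightarrow> \<bar>Q x - P x\<bar> < e"
      using Stone_Weierstrass_real_polynomial_function[of "{0..1}" Q e] e Q
      by (metis compact_Icc continuous_on_subset subset_UNIV)
    then obtain a n where "P = (\<lambda>x. \<Sum>i\<le>n. a i * x ^ i)"
      using real_polynomial_function_iff_sum by blast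
    with poly0[of a n] have vP: "set_integrable lborel S (\<lambda>t. v t * P (\<xi> t))"
      "(LINT t:S|lborel. v t * P (\<xi> t)) = 0"
      by auto
    have diff: "set_integrable lborel S (\<lambda>t. v t * Q (\<xi> t) - v t * P (\<xi> t))"
      by (rule set_integral_diff[OF vQ vP(1)])
    have "(LINT t:S|lborel. v t * Q (\<xi> t)) = (LINT t:S|lborel. v t * Q (\<xi> t) - v t * P (\<xi> t))"
      using set_integral_diff(2)[OF vQ vP(1)] vP(2) by simp
    also have "norm \<dots> \<le> (LINT t:S|lborel. norm (v t * Q (\<xi> t) - v t * P (\<xi> t)))"
      by (rule set_integral_norm_bound[OF diff])
    also have "\<dots> \<le> (LINT t:S|lborel. e * \<bar>v t\<bar>)"
    proof (rule set_integral_mono)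
      show "set_integrable lborel S (\<lambda>t. norm (v t * Q (\<xi> t) - v t * P (\<xi> t)))"
        unfolding real_norm_def by (rule set_integrable_abs[OF diff])
      show "set_integrable lborel S (\<lambda>t. e * \<bar>v t\<bar>)"
        by (intro set_integrable_mult_right set_integrable_abs v)
      fix t assume "t \<in> S"
      then have "\<bar>Q (\<xi> t) - P (\<xi> t)\<bar> \<le> e"
        using P(2)[OF range] by fastforce
      then have "\<bar>Q (\<xi> t) - P (\<xi> t)\<bar> * \<bar>v t\<bar> \<le> e * \<bar>v t\<bar>"
        by (rule mult_right_mono) simp
      then show "norm (v t * Q (\<xi> t) - v t * P (\<xi> t)) \<le> e * \<bar>v t\<bar>"
        by (simp add: mult.commute flip: right_diff_distrib abs_mult)
    qed
    also have "\<dots> = e * J"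
      by (simp only: J_def set_integral_mult_right)
    finally show ?thesis
      by simp
  qed
  show "(LINT t:S|lborel. v t * Q (\<xi> t)) = 0"
  proof (rule ccontr)
    let ?I = "LINT t:S|lborel. v t * Q (\<xi> t)"
    assume "?I \<noteq> 0"
    then have I: "0 < \<bar>?I\<bar>" by simp
    \<comment> \<open>The choice \<open>e = \<bar>?I\<bar> / (J + 1)\<close>: adding 1 avoids
      division by zero and makes the next inequality strict.\<close>
    then have "\<bar>?I\<bar> \<le> \<bar>?I\<bar> / (J + 1) * J"
      using J by (intro small) simp
    also have "\<dots> < \<bar>?I\<bar>"
      using I J by (simp add: field_simps)
    finally show False by simp
  qed
qed

text \<open>
  Testing with the derivatives of the Gaussians \<open>exp (- (n + 1) * t\<^sup>2)\<close> makes all moments of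
  \<open>u t * t * exp (- t\<^sup>2)\<close> in the variable \<open>exp (- t\<^sup>2)\<close> vanish.
\<close>

lemma regular_dist_deriv_zero:
  assumes temp: "tempered_fun u" and cont: "continuous_on {0<..} u"
    and zero: "\<And>\<phi>. schwartz \<phi> \<Longrightarrow> regular_dist u (deriv \<phi>) = 0" and t0: "0 < t0"
  shows "u t0 = 0"
proof (rule ccontr)
  assume nz: "u t0 \<noteq> 0"
  define v where "v t = u t * (t * exp (- t\<^sup>2))" for t
  define \<xi> where "\<xi> t = exp (- t\<^sup>2)" for t :: real
  have moment: "set_integrable lborel {0<..} (\<lambda>t. v t * \<xi> t ^ n) \<and>
      (LINT t:{0<..}|lborel. v t * \<xi> t ^ n) = 0" for n
  proof -
    \<comment> \<open>The rate must be positive already for n = 0. The surplus factor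
      \<open>exp (- t\<^sup>2)\<close> belongs to \<open>v\<close> and makes \<open>v\<close>
      integrable; the factor \<open>t\<close> in \<open>v\<close> comes from differentiating the
      Gaussian.\<close>
    define a where "a = real n + 1"
    define b where "b = - 2 * a"
    have a: "0 < a" and b: "b \<noteq> 0" by (simp_all add: a_def b_def)
    define \<phi> where "\<phi> = (\<lambda>x::real. exp (- a * x\<^sup>2))"
    have \<phi>: "schwartz \<phi>"
      unfolding \<phi>_def by (rule schwartz_gaussian[OF a])
    have d: "deriv \<phi> x = b * (x * exp (- a * x\<^sup>2))" for x
      unfolding \<phi>_def b_def by (rule DERIV_imp_deriv) (auto intro!: derivative_eq_intros)
    have "exp (- a * t\<^sup>2) = exp (- t\<^sup>2) * \<xi> t ^ n" for t
      by (simp add: \<xi>_def a_def algebra_simps flip: exp_add exp_of_nat_mult)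
    then have *: "u t * deriv \<phi> t = b * (v t * \<xi> t ^ n)" for t
      by (simp add: d v_def)
    have "set_integrable lborel {0<..} (\<lambda>t. b * (v t * \<xi> t ^ n))"
      using tempered_schwartz_integrable[OF temp schwartz_deriv[OF \<phi>]] unfolding * .
    moreover have "(LINT t:{0<..}|lborel. b * (v t * \<xi> t ^ n)) = 0"
      using zero[OF \<phi>] unfolding regular_dist_def * .
    ultimately show ?thesis
      using b by simp
  qed
  define s where "s = sgn (u t0)"
  have "isCont u t0"
    using cont t0 by (simp add: continuous_on_eq_continuous_at)
  then have "((\<lambda>t. s * u t) \<longlongrightarrow> s * u t0) (nhds t0)"
    by (intro tendsto_intros) (simp add: tendsto_at_iff_tendsto_nhds isCont_def)
  moreover have "0 < s * u t0"
    using nz by (auto simp: s_def sgn_real_def)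
  ultimately have "\<forall>\<^sub>F t in nhds t0. 0 < s * u t"
    by (rule order_tendstoD(1))
  moreover have "\<forall>\<^sub>F t in nhds t0. t \<in> {0<..}"
    using t0 by (intro eventually_nhds_in_open) auto
  ultimately have "\<forall>\<^sub>F t in nhds t0. 0 < s * u t \<and> 0 < t"
    by eventually_elim simp
  then obtain d where d: "0 < d" "\<And>t. dist t t0 < d \<Longrightarrow> 0 < s * u t \<and> 0 < t"
    unfolding eventually_nhds_metric by blast
  \<comment> \<open>Half the radius keeps the endpoints inside the ball, which gives
    \<open>0 < l\<close>.\<close>
  define l r where "l = t0 - d / 2" and "r = t0 + d / 2"
  have lr: "l < r" "0 < l" and pos: "\<And>t. l < t \<Longrightarrow> t < r \<Longrightarrow> 0 < s * u t"
    using d(1) d(2)[of "t0 - d / 2"] d(2) by (auto simp: l_def r_def dist_real_def)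
  \<comment> \<open>A continuous bump in the variable \<xi>: positive exactly between
    \<open>\<xi> r\<close> and \<open>\<xi> l\<close>. Since \<xi> is decreasing on t > 0,
    \<open>Q (\<xi> t)\<close> is there a bump supported between \<open>l\<close> and
    \<open>r\<close>, with the endpoints in reversed order.\<close>
  define Q where "Q x = max 0 ((x - \<xi> r) * (\<xi> l - x))" for x
  have \<xi>_mono: "\<xi> t < \<xi> t' \<longleftrightarrow> t' < t" if "0 < t" "0 < t'" for t t'
  proof -
    have "t\<^sup>2 \<le> t'\<^sup>2 \<longleftrightarrow> t \<le> t'"
      using that by (intro power_mono_iff) auto
    then have "t'\<^sup>2 < t\<^sup>2 \<longleftrightarrow> t' < t"
      by (metis not_le)
    then show ?thesis
      by (simp add: \<xi>_def)
  qed
  have Q_pos: "0 < Q (\<xi> t)" if "l < t" "t < r" for t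
    using that lr by (simp add: Q_def less_max_iff_disj \<xi>_mono)
  have Q_zero: "Q (\<xi> t) = 0" if "0 < t" "\<not> (l < t \<and> t < r)" for t
  proof -
    have "\<xi> t \<le> \<xi> r \<or> \<xi> l \<le> \<xi> t"
      using that lr \<xi>_mono[of r t] \<xi>_mono[of t l] by force
    moreover have "\<xi> r < \<xi> l"
      using lr by (simp add: \<xi>_mono)
    ultimately have "(\<xi> t - \<xi> r) * (\<xi> l - \<xi> t) \<le> 0"
      by (auto simp: mult_le_0_iff)
    then show ?thesis
      by (simp add: Q_def)
  qed
  have Q_integral: "set_integrable lborel {0<..} (\<lambda>t. v t * Q (\<xi> t))"
    "(LINT t:{0<..}|lborel. v t * Q (\<xi> t)) = 0"
  proof -
    have "set_integrable lborel {0<..} v"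
      using moment[of 0] by simp
    moreover have "\<xi> t \<in> {0..1}" for t
      by (simp add: \<xi>_def)
    moreover have "\<xi> \<in> borel_measurable borel"
      unfolding \<xi>_def by measurable
    moreover have "continuous_on UNIV Q"
      unfolding Q_def by (intro continuous_intros)
    ultimately show "set_integrable lborel {0<..} (\<lambda>t. v t * Q (\<xi> t))"
      "(LINT t:{0<..}|lborel. v t * Q (\<xi> t)) = 0"
      using moment moment_zero_imp_zero[of "{0<..}" v \<xi> Q] by blast+
  qed
  \<comment> \<open>A nonnegative function with integral zero that is positive on the nonempty
    interval from \<open>l\<close> to \<open>r\<close>, which would make that interval a null
    set.\<close>
  define w where "w t = indicator {0<..} t *\<^sub>R (s * (v t * Q (\<xi> t)))" for t
  have w_pos: "0 < w t" if "l < t" "t < r" for t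
  proof -
    have "w t = (s * u t) * (t * exp (- t\<^sup>2)) * Q (\<xi> t)"
      using that lr by (simp add: w_def v_def)
    then show ?thesis
      using that lr pos[OF that] Q_pos[OF that] by simp
  qed
  have w_nonneg: "0 \<le> w t" for t
  proof (cases "l < t \<and> t < r")
    case True
    then show ?thesis using w_pos[of t] by simp
  next
    case False
    then have "w t = 0"
      using Q_zero[of t] by (simp add: w_def indicator_def)
    then show ?thesis by simp
  qed
  have "integrable lborel w"
    using set_integrable_mult_right[OF Q_integral(1), of s] by (simp add: set_integrable_def w_def[abs_def])
  moreover have "integral\<^sup>L lborel w = (LINT t:{0<..}|lborel. s * (v t * Q (\<xi> t)))"
    by (simp only: set_lebesgue_integral_def w_def[abs_def])
  then have "integral\<^sup>L lborel w = 0"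
    by (simp only: set_integral_mult_right Q_integral(2) mult_zero_right)
  ultimately have "AE t in lborel. w t = 0"
    using w_nonneg by (subst (asm) integral_nonneg_eq_0_iff_AE) auto
  then have "AE t in lborel. t \<notin> {l<..<r}"
    by eventually_elim (use w_pos in force)
  then have "{l<..<r} \<in> null_sets lborel"
    by (subst (asm) AE_iff_null_sets[symmetric]) auto
  then show False
    using lr by auto
qed

section \<open>The Caputo-Fabrizio equation\<close>

lemma set_integrable_exp_mult:
  fixes f :: "real \<Rightarrow> real"
  assumes "set_integrable lborel {a<..<b} f" "0 \<le> c"
  shows "set_integrable lborel {a<..<b} (\<lambda>t. exp (c * t) * f t)"
proof (rule set_integrable_bound)
  show "set_integrable lborel {a<..<b} (\<lambda>t. exp (c * b) * f t)"
    by (intro set_integrable_mult_right assms)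
  have [measurable]: "(\<lambda>t. indicator {a<..<b} t *\<^sub>R f t) \<in> borel_measurable lborel"
    using assms(1) unfolding set_integrable_def by (rule borel_measurable_integrable)
  have "(\<lambda>t. exp (c * t) * (indicator {a<..<b} t *\<^sub>R f t)) \<in> borel_measurable lborel"
    by measurable
  then show "set_borel_measurable lborel {a<..<b} (\<lambda>t. exp (c * t) * f t)"
    by (simp add: set_borel_measurable_def mult.left_commute)
  show "AE t in lborel. t \<in> {a<..<b} \<longrightarrow> norm (exp (c * t) * f t) \<le> norm (exp (c * b) * f t)"
    using assms(2) by (auto simp: abs_mult intro!: mult_right_mono mult_left_mono)
qed

lemma zero_if_zero_derivative:
  fixes f :: "real \<Rightarrow> real"
  assumes "\<And>t. a < t \<Longrightarrow> (f has_field_derivative 0) (at t)" "(f \<longlongrightarrow> 0) (at_right a)" "a < t"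
  shows "f t = 0"
  using set_integral_FTC[of a t "\<lambda>t. 0" f 0] assms by (simp add: set_integrable_def)

text \<open>With \<open>D\<close> the residual of the pointwise equation divided by -A, the residual
  of the integrated equation is \<open>R - D\<close>, where R' = - c D and R(0+) = 0. If
  \<open>D\<close> vanishes, \<open>R\<close> is constant and so zero; if \<open>R = D\<close>, then
  R' = - c R and again R = 0. Only \<open>R\<close> is differentiated, never
  \<open>g\<close>.\<close>

lemma cf_equation_iff_integral_equation:
  fixes y g :: "real \<Rightarrow> real"
  assumes c: "0 < c" and A: "A \<noteq> 0"
    and diff: "\<And>t. 0 < t \<Longrightarrow> y differentiable (at t)"
    and int: "\<And>b. 0 < b \<Longrightarrow> set_integrable lborel {0<..<b} (deriv y)"
    and lim: "(y \<longlongrightarrow> y0) (at_right 0)"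
    and y: "\<And>b. 0 < b \<Longrightarrow> set_integrable lborel {0<..<b} y"
    and g: "\<And>b. 0 < b \<Longrightarrow> set_integrable lborel {0<..<b} g" "continuous_on {0<..} g"
  shows "(\<forall>t>0. A * (LINT \<tau>:{0..t}|lborel. exp (- c * (t - \<tau>)) * deriv y \<tau>) = g t) \<longleftrightarrow>
    (\<forall>t>0. y t - y0 - g t / A - c / A * (LINT s:{0<..<t}|lborel. g s) = 0)"
proof -
  define G where "G = (\<lambda>t. LINT s:{0<..<t}|lborel. g s)"
  \<comment> \<open>Chosen so that \<open>exp (c * t) * y t - c * Y t\<close> is an antiderivative
    of \<open>exp (c * t) * deriv y t\<close>, which is integration by parts without regularity of
    \<open>deriv y\<close>.\<close>
  define Y where "Y = (\<lambda>t. LINT s:{0<..<t}|lborel. exp (c * s) * y s)"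
  have dy: "(y has_field_derivative deriv y t) (at t)" if "0 < t" for t
    using diff[OF that] by (simp add: DERIV_deriv_iff_real_differentiable)
  have G: "(G has_field_derivative g t) (at t)" if "0 < t" for t
    unfolding G_def using primitive(1)[OF g(2) g(1) that] .
  have G0: "(G \<longlongrightarrow> 0) (at_right 0)"
    unfolding G_def using primitive(2)[OF g(2) g(1)] .
  have ycont: "continuous_on {0<..} (\<lambda>s. exp (c * s) * y s)"
    by (intro continuous_intros continuous_at_imp_continuous_on ballI) (auto intro: DERIV_isCont dy)
  have yint: "set_integrable lborel {0<..<b} (\<lambda>s. exp (c * s) * y s)" if "0 < b" for b
    using set_integrable_exp_mult[OF y[OF that]] c by simp
  have Y: "(Y has_field_derivative exp (c * t) * y t) (at t)" if "0 < t" for t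
    unfolding Y_def using primitive(1)[OF ycont yint that] .
  have Y0: "(Y \<longlongrightarrow> 0) (at_right 0)"
    unfolding Y_def using primitive(2)[OF ycont yint] .
  have expY: "exp (- c * t) * exp (c * t) = 1" for t
    by (simp flip: exp_add)
  have cf: "(LINT \<tau>:{0..t}|lborel. exp (- c * (t - \<tau>)) * deriv y \<tau>) =
      y t - exp (- c * t) * (c * Y t + y0)" if t: "0 < t" for t
  proof -
    have "(LINT \<tau>:{0..t}|lborel. exp (- c * (t - \<tau>)) * deriv y \<tau>) =
        (LINT \<tau>:{0<..<t}|lborel. exp (- c * (t - \<tau>)) * deriv y \<tau>)"
      by (rule set_integral_discrete_difference[where X = "{0, t}"]) auto
    also have "\<dots> = (LINT \<tau>:{0<..<t}|lborel. exp (- c * t) * (exp (c * \<tau>) * deriv y \<tau>))"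
      by (rule set_lebesgue_integral_cong) (auto simp: algebra_simps simp flip: exp_add)
    also have "\<dots> = exp (- c * t) * (LINT \<tau>:{0<..<t}|lborel. exp (c * \<tau>) * deriv y \<tau>)"
      by (rule set_integral_mult_right)
    also have "(LINT \<tau>:{0<..<t}|lborel. exp (c * \<tau>) * deriv y \<tau>) =
        (exp (c * t) * y t - c * Y t) - (exp (c * 0) * y0 - c * 0)"
    proof (rule set_integral_FTC[OF t])
      show "set_integrable lborel {0<..<t} (\<lambda>\<tau>. exp (c * \<tau>) * deriv y \<tau>)"
        using set_integrable_exp_mult[OF int[OF t]] c by simp
      show "((\<lambda>t. exp (c * t) * y t - c * Y t) has_field_derivative exp (c * s) * deriv y s) (at s)"
        if "0 < s" for s
        by (auto intro!: derivative_eq_intros dy Y that simp: algebra_simps)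
      show "((\<lambda>t. exp (c * t) * y t - c * Y t) \<longlongrightarrow> exp (c * 0) * y0 - c * 0) (at_right 0)"
        by (intro tendsto_intros lim Y0)
    qed
    finally show ?thesis
      using expY[of t] by (simp add: algebra_simps)
  qed
  define R where "R t = exp (- c * t) * (c * Y t + y0) - y0 - c / A * G t" for t
  define D where "D t = g t / A - (y t - exp (- c * t) * (c * Y t + y0))" for t
  have R: "(R has_field_derivative - c * D t) (at t)" if "0 < t" for t
  proof -
    have "(R has_field_derivative
        - c * exp (- c * t) * (c * Y t + y0) + exp (- c * t) * (c * (exp (c * t) * y t)) - c / A * g t)
        (at t)"
      unfolding R_def using A by (auto intro!: derivative_eq_intros Y G that)
    moreover have e: "exp (- c * t) * (c * (exp (c * t) * y t)) = c * y t"
      using expY[of t] by (metis mult.assoc mult.commute mult_1)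
    have "- c * exp (- c * t) * (c * Y t + y0) + exp (- c * t) * (c * (exp (c * t) * y t)) - c / A * g t
        = - c * D t"
      unfolding e by (simp add: D_def algebra_simps)
    ultimately show ?thesis
      by (simp only:)
  qed
  have "(R \<longlongrightarrow> exp (- c * 0) * (c * 0 + y0) - y0 - c / A * 0) (at_right 0)"
    unfolding R_def by (intro tendsto_intros Y0 G0)
  then have R0: "(R \<longlongrightarrow> 0) (at_right 0)"
    by simp
  have eq: "y t - y0 - g t / A - c / A * G t = R t - D t" for t
    by (simp add: R_def D_def)
  have "(\<forall>t>0. A * (LINT \<tau>:{0..t}|lborel. exp (- c * (t - \<tau>)) * deriv y \<tau>) = g t) \<longleftrightarrow> (\<forall>t>0. D t = 0)"
  proof -
    have "A * (LINT \<tau>:{0..t}|lborel. exp (- c * (t - \<tau>)) * deriv y \<tau>) = g t \<longleftrightarrow> D t = 0"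
      if "0 < t" for t
      unfolding cf[OF that] D_def using A by (auto simp: field_simps)
    then show ?thesis
      by simp
  qed
  also have "\<dots> \<longleftrightarrow> (\<forall>t>0. R t - D t = 0)"
  proof
    assume D: "\<forall>t>0. D t = 0"
    have "R t = 0" if "0 < t" for t
      using zero_if_zero_derivative[OF _ R0 that] R D by simp
    with D show "\<forall>t>0. R t - D t = 0"
      by simp
  next
    assume D: "\<forall>t>0. R t - D t = 0"
    \<comment> \<open>Integrating factor for R' = - c R.\<close>
    have "exp (c * t) * R t = 0" if "0 < t" for t
    proof (rule zero_if_zero_derivative[OF _ _ that])
      show "((\<lambda>t. exp (c * t) * R t) has_field_derivative 0) (at s)" if "0 < s" for s
        using D that by (auto intro!: derivative_eq_intros R)
      have "((\<lambda>t. exp (c * t) * R t) \<longlongrightarrow> exp (c * 0) * 0) (at_right 0)"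
        by (intro tendsto_intros R0)
      then show "((\<lambda>t. exp (c * t) * R t) \<longlongrightarrow> 0) (at_right 0)"
        by simp
    qed
    with D show "\<forall>t>0. D t = 0"
      by simp
  qed
  finally show ?thesis
    using eq by (simp add: G_def)
qed

section \<open>The recast equation and its integrated form\<close>

lemma regular_dist_diff:
  assumes "tempered_fun f" "tempered_fun g" "schwartz \<phi>"
  shows "regular_dist (\<lambda>t. f t - g t) \<phi> = regular_dist f \<phi> - regular_dist g \<phi>"
  unfolding regular_dist_def left_diff_distrib
  by (rule set_integral_diff(2)) (intro tempered_schwartz_integrable assms)+

lemma regular_dist_mult: "regular_dist (\<lambda>t. a * f t) \<phi> = a * regular_dist f \<phi>"
  by (simp add: regular_dist_def mult.assoc)

text \<open>Every term is written as the derivative of a function on the half line: \<open>g\<close>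
  as that of \<open>G\<close>, the delta as that of the constant 1. The difference of the two sides
  is then the distributional derivative of the single continuous function \<open>u\<close>.\<close>

lemma halfline_equation_iff_integral_equation:
  assumes y: "tempered_fun y" "continuous_on {0<..} y"
    and g: "tempered_fun g" "continuous_on {0<..} g"
  shows "dist_eq (halfline_derivative y y0)
      (\<lambda>\<phi>. 1 / A * regular_dist g (\<lambda>t. c * \<phi> t - deriv \<phi> t)) \<longleftrightarrow>
    (\<forall>t>0. y t - y0 - g t / A - c / A * (LINT s:{0<..<t}|lborel. g s) = 0)"
proof -
  define G where "G = (\<lambda>t. LINT s:{0<..<t}|lborel. g s)"
  have gint: "set_integrable lborel {0<..<b} g" if "0 < b" for b
    using tempered_set_integrable[OF g(1)] that by simp
  have DG: "(G has_field_derivative g t) (at t)" if "0 < t" for t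
    unfolding G_def using primitive(1)[OF g(2) gint that] .
  have G0: "(G \<longlongrightarrow> 0) (at_right 0)"
    unfolding G_def using primitive(2)[OF g(2) gint] .
  obtain C N where growth: "\<And>t. 0 < t \<Longrightarrow> \<bar>G t\<bar> \<le> C * (1 + t) ^ N"
    using primitive_growth[OF g(1)] unfolding G_def by blast
  have Gcont: "continuous_on {0<..} G"
    by (intro continuous_at_imp_continuous_on ballI) (auto intro: DERIV_isCont DG)
  have G: "tempered_fun G"
    by (rule tempered_fun_polynomial_growth[OF Gcont growth])
  have one: "tempered_fun (\<lambda>t. 1)"
    by (rule tempered_fun_polynomial_growth[of _ 1 0]) auto
  have zero: "tempered_fun (\<lambda>t. 0)"
    by (simp add: tempered_fun_def set_integrable_def)
  define u where "u t = y t - y0 * 1 - 1 / A * g t - c / A * G t" for t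
  have u: "tempered_fun u"
    unfolding u_def by (intro tempered_fun_diff tempered_fun_mult_left y g G one)
  have ucont: "continuous_on {0<..} u"
    unfolding u_def by (intro continuous_intros y g Gcont)
  have key: "halfline_derivative y y0 \<phi> - 1 / A * regular_dist g (\<lambda>t. c * \<phi> t - deriv \<phi> t) =
      - regular_dist u (deriv \<phi>)" if \<phi>: "schwartz \<phi>" for \<phi>
  proof -
    note d\<phi> = schwartz_deriv[OF \<phi>]
    have u_eq: "regular_dist u (deriv \<phi>) = regular_dist y (deriv \<phi>) -
        y0 * regular_dist (\<lambda>t. 1) (deriv \<phi>) - 1 / A * regular_dist g (deriv \<phi>) -
        c / A * regular_dist G (deriv \<phi>)"
      unfolding u_def
      by (subst regular_dist_diff, (intro tempered_fun_diff tempered_fun_mult_left y g G one d\<phi>)+)+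
        (simp only: regular_dist_mult)
    \<comment> \<open>The derivative of the Heaviside function is the delta; the left side is zero
      and kept only to match the jump formula.\<close>
    have one_eq: "regular_dist (\<lambda>t. 0) \<phi> = - regular_dist (\<lambda>t. 1) (deriv \<phi>) - 1 * \<phi> 0"
      by (rule regular_dist_by_parts[where C = 1 and N = 0]) (auto simp: zero \<phi>)
    \<comment> \<open>No delta appears here because \<open>G\<close> tends to 0 at 0.\<close>
    have g_eq: "regular_dist g \<phi> = - regular_dist G (deriv \<phi>) - 0 * \<phi> 0"
      by (rule regular_dist_by_parts[OF DG g(2,1) growth G0 \<phi>])
    have lincomb: "regular_dist g (\<lambda>t. c * \<phi> t - deriv \<phi> t) =
        c * regular_dist g \<phi> - regular_dist g (deriv \<phi>)"
      using regular_dist_lincomb[OF g(1) \<phi> d\<phi>, of c "-1"] by simp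
    have \<phi>0: "\<phi> 0 = - regular_dist (\<lambda>t. 1) (deriv \<phi>)"
      using one_eq by (simp add: regular_dist_def)
    show ?thesis
      unfolding halfline_derivative_def dist_derivative_def dirac_def u_eq lincomb g_eq \<phi>0
      by (simp add: algebra_simps add_divide_distrib diff_divide_distrib)
  qed
  have "dist_eq (halfline_derivative y y0)
      (\<lambda>\<phi>. 1 / A * regular_dist g (\<lambda>t. c * \<phi> t - deriv \<phi> t)) \<longleftrightarrow>
    (\<forall>\<phi>. schwartz \<phi> \<longrightarrow> regular_dist u (deriv \<phi>) = 0)"
    unfolding dist_eq_def using key by fastforce
  also have "\<dots> \<longleftrightarrow> (\<forall>t>0. u t = 0)"
  proof
    assume "\<forall>\<phi>. schwartz \<phi> \<longrightarrow> regular_dist u (deriv \<phi>) = 0"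
    then show "\<forall>t>0. u t = 0"
      using regular_dist_deriv_zero[OF u ucont] by blast
  next
    assume "\<forall>t>0. u t = 0"
    then have "regular_dist u \<phi> = (LINT t:{0::real<..}|lborel. 0)" for \<phi>
      unfolding regular_dist_def by (intro set_lebesgue_integral_cong) auto
    then show "\<forall>\<phi>. schwartz \<phi> \<longrightarrow> regular_dist u (deriv \<phi>) = 0"
      by simp
  qed
  finally show ?thesis
    by (simp add: u_def G_def)
qed

theorem theorem6:
  fixes M :: "real \<Rightarrow> real" and \<alpha> :: real
    and F :: "real \<Rightarrow> real \<Rightarrow> real" and y :: "real \<Rightarrow> real" and y0 F0 :: real
  assumes "0 < \<alpha>" and "\<alpha> < 1"
    and "M 0 = 1" and "M 1 = 1" and "M \<alpha> \<noteq> 0"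
    and "tempered_fun y"
    and "tempered_fun (\<lambda>t. F t (y t))"
    and "continuous_on {0<..} (\<lambda>t. F t (y t))"
    and "((\<lambda>t. F t (y t)) \<longlongrightarrow> F0) (at_right 0)"
  shows
    \<comment> \<open>the pointwise equation, for differentiable \<open>y\<close> with \<open>y(0\<^sup>+) = y0\<close>\<close>
    "((\<forall>t>0. y differentiable (at t)) \<and>
      (\<forall>b>0. set_integrable lborel {0<..<b} (deriv y)) \<and>
      (y \<longlongrightarrow> y0) (at_right 0) \<longrightarrow>
        ((\<forall>t>0. cf_derivative M \<alpha> y t = F t (y t)) \<longleftrightarrow>
         dist_eq (halfline_derivative y y0)
           (\<lambda>\<phi>. (1 - \<alpha>) / M \<alpha> * halfline_derivative (\<lambda>t. F t (y t)) F0 \<phi>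
               + \<alpha> / M \<alpha> * regular_dist (\<lambda>t. F t (y t)) \<phi>
               + (1 - \<alpha>) / M \<alpha> * F0 * dirac \<phi>))) \<and>
    \<comment> \<open>the equation between distributions, for an arbitrary initial value \<open>y0\<close>\<close>
     (dist_eq (cf_distribution M \<alpha> (halfline_derivative y y0)) (regular_dist (\<lambda>t. F t (y t))) \<longleftrightarrow>
      dist_eq (halfline_derivative y y0)
        (\<lambda>\<phi>. (1 - \<alpha>) / M \<alpha> * halfline_derivative (\<lambda>t. F t (y t)) F0 \<phi>
            + \<alpha> / M \<alpha> * regular_dist (\<lambda>t. F t (y t)) \<phi>
            + (1 - \<alpha>) / M \<alpha> * F0 * dirac \<phi>)) \<and>
     tempered_dist_Rplus (halfline_derivative y y0) \<and>
     tempered_dist_Rplus (halfline_derivative (\<lambda>t. F t (y t)) F0) \<and>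
     tempered_dist_Rplus (regular_dist (\<lambda>t. F t (y t))) \<and>
     tempered_dist_Rplus dirac"
proof -
  define g where "g t = F t (y t)" for t
  define c where "c = \<alpha> / (1 - \<alpha>)"
  define A where "A = M \<alpha> / (1 - \<alpha>)"
  \<comment> \<open>The form of the right side with all derivatives moved onto the test function;
    both equivalences are proved against it.\<close>
  define T where "T \<phi> = (1 - \<alpha>) / M \<alpha> * regular_dist g (\<lambda>t. c * \<phi> t - deriv \<phi> t)" for \<phi>
  define rhs where "rhs \<phi> = (1 - \<alpha>) / M \<alpha> * halfline_derivative g F0 \<phi>
    + \<alpha> / M \<alpha> * regular_dist g \<phi> + (1 - \<alpha>) / M \<alpha> * F0 * dirac \<phi>" for \<phi>
  have g: "tempered_fun g" "continuous_on {0<..} g"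
    using assms(7,8) by (simp_all add: g_def[abs_def])
  have c: "0 < c" and A: "A \<noteq> 0" and A': "1 / A = (1 - \<alpha>) / M \<alpha>"
    using assms(1,2,5) by (simp_all add: c_def A_def)
  have "rhs \<phi> = T \<phi>" if \<phi>: "schwartz \<phi>" for \<phi>
  proof -
    define k where "k = (1 - \<alpha>) / M \<alpha>"
    have lincomb: "regular_dist g (\<lambda>t. c * \<phi> t - deriv \<phi> t) =
        c * regular_dist g \<phi> - regular_dist g (deriv \<phi>)"
      using regular_dist_lincomb[OF g(1) \<phi> schwartz_deriv[OF \<phi>], of c "-1"] by simp
    have ck: "\<alpha> / M \<alpha> = k * c"
      using assms(2) by (simp add: c_def k_def)
    show ?thesis
      unfolding rhs_def T_def halfline_derivative_def dist_derivative_def lincomb ck k_def[symmetric]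
      by (simp add: algebra_simps)
  qed
  then have rhs_eq: "dist_eq u rhs \<longleftrightarrow> dist_eq u T" for u
    by (simp add: dist_eq_def)
  have pointwise: "(\<forall>t>0. cf_derivative M \<alpha> y t = g t) \<longleftrightarrow> dist_eq (halfline_derivative y y0) T"
    if diff: "\<forall>t>0. y differentiable (at t)" and int: "\<forall>b>0. set_integrable lborel {0<..<b} (deriv y)"
      and lim: "(y \<longlongrightarrow> y0) (at_right 0)"
  proof -
    have ycont: "continuous_on {0<..} y"
      using diff by (intro continuous_at_imp_continuous_on ballI differentiable_imp_continuous_within) auto
    have "(\<forall>t>0. cf_derivative M \<alpha> y t = g t) \<longleftrightarrow>
        (\<forall>t>0. y t - y0 - g t / A - c / A * (LINT s:{0<..<t}|lborel. g s) = 0)"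
      unfolding cf_derivative_def c_def[symmetric] A_def[symmetric]
      by (rule cf_equation_iff_integral_equation[OF c A])
        (use diff int lim g assms(6) tempered_set_integrable in auto)
    also have "\<dots> \<longleftrightarrow> dist_eq (halfline_derivative y y0) T"
      using halfline_equation_iff_integral_equation[OF assms(6) ycont g, of y0 A c]
      unfolding T_def[abs_def] A' by blast
    finally show ?thesis .
  qed
  \<comment> \<open>Here \<open>y\<close> is only a tempered function with no continuity, so this
    part inverts the kernel directly and bypasses the integrated equation.\<close>
  have distributional: "dist_eq (cf_distribution M \<alpha> (halfline_derivative y y0)) (regular_dist g) \<longleftrightarrow>
      dist_eq (halfline_derivative y y0) T"
    unfolding T_def[abs_def] c_def by (rule cf_distribution_eq_iff[where M = M, OF assms(5,1,2)])
  have "tempered_dist_Rplus (halfline_derivative y y0)" "tempered_dist_Rplus (halfline_derivative g F0)"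
    "tempered_dist_Rplus (regular_dist g)"
    by (intro tempered_halfline_derivative_Rplus tempered_regular_dist_Rplus assms(6) g)+
  then show ?thesis
    using pointwise distributional tempered_dirac_Rplus
    unfolding rhs_eq[symmetric] rhs_def[abs_def] g_def[abs_def] by blast
qed

end
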